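(* Assume that the random vector $\mathbf{c}$ is finitely distributed and that the input consists of its support $U$ together with the corresponding probabilities. Then Problem (SP) can be solved in $\mathcal{O}(|U| n \log(|U| n))$ time.
   Context: Problem (SP), the stochastic bilevel continuous knapsack problem, is: maximize $\mathbb{E}_{\mathbf{c}}(d^\top x^{\mathbf{c}} - \delta b)$ over $b \in [b^-, b^+]$, where for each realization $c$ of the random vector $\mathbf{c}$ the follower's solution $x^{c}$ is an optimal solution of $\max\{c^\top x : a^\top x \le b,\ x \in [0,1]^n\}$. Here $a \in \mathbb{N}^n$ with $a>0$ are item sizes, $d \in \mathbb{Z}^n$ are the leader's item values, $\delta \ge 0$ is a price per unit of capacity, and $0 \le b^- \le b^+ \le A := \sum_{i=1}^n a_i$. It is assumed that $\mathbb{P}(\mathbf{c}_i/a_i = \mathbf{c}_j/a_j) = 0$ for $i \ne j$ and $\mathbb{P}(\mathbf{c}_i = 0) = 0$, so the follower's optimal solution is almost surely unique (results hold in both the optimistic and the pessimistic setting). *)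

theory Defs
  imports
    "HOL-Probability.Probability_Mass_Function"
    "HOL-Library.Landau_Symbols"
begin

section \<open>The stochastic bilevel continuous knapsack problem\<close>

text \<open>
  The dimension \<open>n\<close> varies inside the statement, so vectors are lists of length \<open>n\<close>;
  \<open>n\<close> itself is the length of \<open>sizes\<close>. The random vector \<open>c\<close> is given by its distribution
  \<open>cdist\<close>, whose support \<open>U\<close> is \<open>set_pmf cdist\<close>.
\<close>

record sp_instance =
  sizes :: "nat list"
  profits :: "int list"
  price :: real
  b_min :: real
  b_max :: real
  cdist :: "real list pmf"

definition dot :: "real list \<Rightarrow> real list \<Rightarrow> real" where
  "dot u v = (\<Sum>i<length u. u ! i * v ! i)"

definition valid_instance :: "sp_instance \<Rightarrow> bool" where
  "valid_instance I \<longleftrightarrow>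
     (\<forall>i<length (sizes I). 0 < sizes I ! i) \<and>
     length (profits I) = length (sizes I) \<and>
     0 \<le> price I \<and>
     0 \<le> b_min I \<and> b_min I \<le> b_max I \<and>
     b_max I \<le> (\<Sum>i<length (sizes I). real (sizes I ! i)) \<and>
     (\<forall>c\<in>set_pmf (cdist I). length c = length (sizes I)) \<and>
     (\<forall>i<length (sizes I). \<forall>j<length (sizes I). i \<noteq> j \<longrightarrow>
        measure_pmf.prob (cdist I)
          {c. c ! i / real (sizes I ! i) = c ! j / real (sizes I ! j)} = 0) \<and>
     (\<forall>i<length (sizes I). measure_pmf.prob (cdist I) {c. c ! i = 0} = 0)"

definition follower_feasible :: "nat list \<Rightarrow> real \<Rightarrow> real list \<Rightarrow> bool" where
  "follower_feasible a b x \<longleftrightarrow>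
     length x = length a \<and> dot (map real a) x \<le> b \<and> (\<forall>i<length a. x ! i \<in> {0..1})"

definition follower_optimal :: "nat list \<Rightarrow> real \<Rightarrow> real list \<Rightarrow> real list \<Rightarrow> bool" where
  "follower_optimal a b c x \<longleftrightarrow> is_arg_max (dot c) (follower_feasible a b) x"

text \<open>
  \<open>X b c\<close> is an optimal follower's reaction to the capacity \<open>b\<close> under the realization \<open>c\<close>.
  The optimistic and the pessimistic setting correspond to particular choices of \<open>X\<close>.
\<close>

definition follower_response ::
  "sp_instance \<Rightarrow> (real \<Rightarrow> real list \<Rightarrow> real list) \<Rightarrow> bool" where
  "follower_response I X \<longleftrightarrow>
     (\<forall>b\<in>{b_min I..b_max I}. \<forall>c\<in>set_pmf (cdist I). follower_optimal (sizes I) b c (X b c))"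

lemma follower_optimal_exists:
  assumes "0 \<le> b" "length c = length a"
  shows "\<exists>x. follower_optimal a b c x"
proof -
  define n where "n = length a"
  define K :: "(nat \<Rightarrow> real) set" where "K = (\<Pi>\<^sub>E i\<in>UNIV. if i < n then {0..1} else {0})"
  define F where "F = K \<inter> {f. (\<Sum>i<n. real (a ! i) * f i) \<le> b}"
  have "compact K"
    unfolding K_def compactin_euclidean_iff[symmetric] euclidean_product_topology[symmetric]
    by (subst compactin_PiE) (auto simp: compactin_euclidean_iff)
  moreover have "closed {f :: nat \<Rightarrow> real. (\<Sum>i<n. real (a ! i) * f i) \<le> b}"
    by (intro closed_Collect_le continuous_intros continuous_on_product_coordinates)
  ultimately have "compact F"
    unfolding F_def by (rule compact_Int_closed)
  moreover have "(\<lambda>_. 0) \<in> F"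
    using assms by (auto simp: F_def K_def)
  moreover have "continuous_on F (\<lambda>f. \<Sum>i<n. c ! i * f i)"
    by (intro continuous_intros continuous_on_subset[OF continuous_on_product_coordinates]) auto
  ultimately obtain f where f: "f \<in> F"
    and max: "\<And>g. g \<in> F \<Longrightarrow> (\<Sum>i<n. c ! i * g i) \<le> (\<Sum>i<n. c ! i * f i)"
    using continuous_attains_sup[of F] by blast
  have "follower_feasible a b (map f [0..<n])"
    using f by (auto simp: follower_feasible_def dot_def F_def K_def n_def PiE_iff split: if_splits)
  moreover have "dot c y \<le> dot c (map f [0..<n])" if "follower_feasible a b y" for y
  proof -
    have "(\<lambda>i. if i < n then y ! i else 0) \<in> F"
      using that by (simp add: follower_feasible_def dot_def F_def K_def n_def PiE_iff)
    from max[OF this] show ?thesis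
      using assms(2) by (simp add: dot_def n_def)
  qed
  ultimately have "follower_optimal a b c (map f [0..<n])"
    unfolding follower_optimal_def is_arg_max_linorder by blast
  then show ?thesis ..
qed

lemma follower_response_exists:
  assumes "valid_instance I"
  shows "\<exists>X. follower_response I X"
proof (intro exI)
  show "follower_response I (\<lambda>b c. SOME x. follower_optimal (sizes I) b c x)"
    unfolding follower_response_def
  proof (intro ballI)
    fix b c assume "b \<in> {b_min I..b_max I}" "c \<in> set_pmf (cdist I)"
    with assms have "0 \<le> b" "length c = length (sizes I)"
      by (auto simp: valid_instance_def)
    then show "follower_optimal (sizes I) b c (SOME x. follower_optimal (sizes I) b c x)"
      by (rule someI_ex[OF follower_optimal_exists])
  qed
qed

definition leader_objective ::
  "sp_instance \<Rightarrow> (real \<Rightarrow> real list \<Rightarrow> real list) \<Rightarrow> real \<Rightarrow> real" where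
  "leader_objective I X b =
     measure_pmf.expectation (cdist I)
       (\<lambda>c. dot (map real_of_int (profits I)) (X b c) - price I * b)"

definition sp_optimal ::
  "sp_instance \<Rightarrow> (real \<Rightarrow> real list \<Rightarrow> real list) \<Rightarrow> real \<Rightarrow> bool" where
  "sp_optimal I X b \<longleftrightarrow>
     is_arg_max (leader_objective I X) (\<lambda>b. b \<in> {b_min I..b_max I}) b"


section \<open>Random access machine with real arithmetic\<close>

text \<open>
  Running times are worst-case numbers of elementary operations of a random access machine.
  The memory consists of named, unbounded arrays of natural numbers (used for
  addressing and counting) and of named, unbounded arrays of real numbers; scalars are cells
  at a constant index. Elementary operations are loading a constant, reading or writing one
  cell, addition and subtraction of natural numbers, the four field operations on reals,
  comparisons and Boolean connectives. There is no rounding and no conversion from reals to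
  naturals, and programs only contain integer constants.
\<close>

type_synonym name = string

record ram =
  imem :: "name \<Rightarrow> nat \<Rightarrow> nat"
  rmem :: "name \<Rightarrow> nat \<Rightarrow> real"

datatype iexp =
    IConst nat
  | IGet name iexp
  | IAdd iexp iexp
  | ISub iexp iexp

datatype rexp =
    RConst int
  | RGet name iexp
  | RAdd rexp rexp
  | RSub rexp rexp
  | RMul rexp rexp
  | RDiv rexp rexp

datatype bexp =
    ILess iexp iexp
  | RLess rexp rexp
  | BNot bexp
  | BAnd bexp bexp

datatype com =
    Skip
  | IPut name iexp iexp
  | RPut name iexp rexp
  | Seq com com
  | Cond bexp com com
  | While bexp com

primrec ieval :: "ram \<Rightarrow> iexp \<Rightarrow> nat" where
  "ieval s (IConst k) = k"
| "ieval s (IGet x e) = imem s x (ieval s e)"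
| "ieval s (IAdd e f) = ieval s e + ieval s f"
| "ieval s (ISub e f) = ieval s e - ieval s f"

primrec reval :: "ram \<Rightarrow> rexp \<Rightarrow> real" where
  "reval s (RConst k) = real_of_int k"
| "reval s (RGet x e) = rmem s x (ieval s e)"
| "reval s (RAdd e f) = reval s e + reval s f"
| "reval s (RSub e f) = reval s e - reval s f"
| "reval s (RMul e f) = reval s e * reval s f"
| "reval s (RDiv e f) = reval s e / reval s f"

primrec beval :: "ram \<Rightarrow> bexp \<Rightarrow> bool" where
  "beval s (ILess e f) \<longleftrightarrow> ieval s e < ieval s f"
| "beval s (RLess e f) \<longleftrightarrow> reval s e < reval s f"
| "beval s (BNot b) \<longleftrightarrow> \<not> beval s b"
| "beval s (BAnd b c) \<longleftrightarrow> beval s b \<and> beval s c"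

primrec icost :: "iexp \<Rightarrow> nat" where
  "icost (IConst k) = 1"
| "icost (IGet x e) = 1 + icost e"
| "icost (IAdd e f) = 1 + icost e + icost f"
| "icost (ISub e f) = 1 + icost e + icost f"

primrec rcost :: "rexp \<Rightarrow> nat" where
  "rcost (RConst k) = 1"
| "rcost (RGet x e) = 1 + icost e"
| "rcost (RAdd e f) = 1 + rcost e + rcost f"
| "rcost (RSub e f) = 1 + rcost e + rcost f"
| "rcost (RMul e f) = 1 + rcost e + rcost f"
| "rcost (RDiv e f) = 1 + rcost e + rcost f"

primrec bcost :: "bexp \<Rightarrow> nat" where
  "bcost (ILess e f) = 1 + icost e + icost f"
| "bcost (RLess e f) = 1 + rcost e + rcost f"
| "bcost (BNot b) = 1 + bcost b"
| "bcost (BAnd b c) = 1 + bcost b + bcost c"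

text \<open>
  \<open>exec p s t s'\<close>: started in memory \<open>s\<close>, the program \<open>p\<close> halts after exactly \<open>t\<close> elementary
  operations with memory \<open>s'\<close>.
\<close>

inductive exec :: "com \<Rightarrow> ram \<Rightarrow> nat \<Rightarrow> ram \<Rightarrow> bool" where
  Skip: "exec Skip s 1 s"
| IPut: "exec (IPut x i e) s (1 + icost i + icost e)
           (s\<lparr>imem := (imem s)(x := (imem s x)(ieval s i := ieval s e))\<rparr>)"
| RPut: "exec (RPut x i e) s (1 + icost i + rcost e)
           (s\<lparr>rmem := (rmem s)(x := (rmem s x)(ieval s i := reval s e))\<rparr>)"
| Seq: "exec p s t s' \<Longrightarrow> exec q s' u s'' \<Longrightarrow> exec (Seq p q) s (t + u) s''"
| CondTrue: "beval s b \<Longrightarrow> exec p s t s' \<Longrightarrow> exec (Cond b p q) s (1 + bcost b + t) s'"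
| CondFalse: "\<not> beval s b \<Longrightarrow> exec q s t s' \<Longrightarrow> exec (Cond b p q) s (1 + bcost b + t) s'"
| WhileFalse: "\<not> beval s b \<Longrightarrow> exec (While b p) s (1 + bcost b) s"
| WhileTrue: "beval s b \<Longrightarrow> exec p s t s' \<Longrightarrow> exec (While b p) s' u s'' \<Longrightarrow>
    exec (While b p) s (1 + bcost b + t + u) s''"

inductive_cases SkipE: "exec Skip s t s'"
inductive_cases IPutE: "exec (IPut x i e) s t s'"
inductive_cases RPutE: "exec (RPut x i e) s t s'"
inductive_cases SeqE: "exec (Seq p q) s t s'"
inductive_cases CondE: "exec (Cond b p q) s t s'"
inductive_cases WhileE: "exec (While b p) s t s'"

lemma exec_deterministic:
  "exec p s t s' \<Longrightarrow> exec p s u s'' \<Longrightarrow> u = t \<and> s'' = s'"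
proof (induction arbitrary: u s'' rule: exec.induct)
  case Skip
  then show ?case by (elim SkipE) simp
next
  case IPut
  then show ?case by (elim IPutE) simp
next
  case RPut
  then show ?case by (elim RPutE) simp
next
  case (Seq p s t s' q v s2)
  from Seq.prems obtain t1 s1 u1
    where u: "u = t1 + u1" and p: "exec p s t1 s1" and q: "exec q s1 u1 s''"
    by (rule SeqE)
  from Seq.IH(1)[OF p] q have "t1 = t" "exec q s' u1 s''" by simp_all
  with Seq.IH(2)[of u1 s''] u show ?case by simp
next
  case (CondTrue s b p t s' q)
  from CondTrue.prems CondTrue.hyps(1) obtain t1
    where u: "u = 1 + bcost b + t1" and p: "exec p s t1 s''"
    by (auto elim: CondE)
  from CondTrue.IH[OF p] u show ?case by simp
next
  case (CondFalse s b q t s' p)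
  from CondFalse.prems CondFalse.hyps(1) obtain t1
    where u: "u = 1 + bcost b + t1" and q: "exec q s t1 s''"
    by (auto elim: CondE)
  from CondFalse.IH[OF q] u show ?case by simp
next
  case (WhileFalse s b p)
  from WhileFalse.prems show ?case
    by (rule WhileE) (use WhileFalse.hyps in simp_all)
next
  case (WhileTrue s b p t s' v s2)
  from WhileTrue.prems obtain t1 s1 u1
    where u: "u = Suc (bcost b + t1 + u1)" and p: "exec p s t1 s1"
      and w: "exec (While b p) s1 u1 s''"
    by (rule WhileE) (use WhileTrue.hyps(1) in blast)+
  from WhileTrue.IH(1)[OF p] w have "t1 = t" "exec (While b p) s' u1 s''" by simp_all
  with WhileTrue.IH(2)[of u1 s''] u show ?case by simp
qed


section \<open>Input and output\<close>

definition array :: "'a::zero list \<Rightarrow> nat \<Rightarrow> 'a" where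
  "array xs k = (if k < length xs then xs ! k else 0)"

text \<open>
  The support is passed as an enumeration \<open>us\<close>; its vectors are stored one after the other.
  All memory that does not hold input is zero.
\<close>

definition input_state :: "sp_instance \<Rightarrow> real list list \<Rightarrow> ram" where
  "input_state I us = \<lparr>
     imem = (\<lambda>_. array [])(
       ''n'' := array [length (sizes I)],
       ''m'' := array [length us]),
     rmem = (\<lambda>_. array [])(
       ''a'' := array (map real (sizes I)),
       ''d'' := array (map real_of_int (profits I)),
       ''delta'' := array [price I],
       ''b_min'' := array [b_min I],
       ''b_max'' := array [b_max I],
       ''c'' := array (concat us),
       ''p'' := array (map (pmf (cdist I)) us))\<rparr>"

definition solves_within :: "com \<Rightarrow> sp_instance \<Rightarrow> real list list \<Rightarrow> nat \<Rightarrow> bool" where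
  "solves_within prog I us bound \<longleftrightarrow>
     (\<exists>t s. exec prog (input_state I us) t s \<and> t \<le> bound \<and>
        (\<forall>X. follower_response I X \<longrightarrow>
           sp_optimal I X (rmem s ''b'' 0) \<and>
           rmem s ''value'' 0 = leader_objective I X (rmem s ''b'' 0)))"

end

theory Submission
  imports Defs "HOL-Real_Asymp.Real_Asymp"
begin

text \<open>
  In scenario \<open>c\<close> the follower fills the knapsack greedily by decreasing \<open>c\<^sub>i / a\<^sub>i\<close>, so item \<open>i\<close>
  (with \<open>c\<^sub>i > 0\<close>) is packed exactly while the capacity runs through \<open>[s, s + a\<^sub>i]\<close>, where \<open>s\<close> is the
  total size of the items with larger ratio. Hence the leader's objective is
  \<open>\<Sum>e. \<sigma> e * max 0 (b - p e) - \<delta> * b\<close> with two events \<open>e\<close> per scenario and item, one at \<open>s\<close> with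
  slope change \<open>prob(c) * d\<^sub>i / a\<^sub>i\<close> and one at \<open>s + a\<^sub>i\<close> with the opposite change. It is affine
  between consecutive events, so it is maximized at an event position or at a bound of the
  capacity range. A first sort of all scenario-item pairs by ratio yields the positions \<open>s\<close>, by
  accumulating sizes per scenario; a second sort, of the events by position, lets a single sweep
  evaluate the objective at all candidates. Both sorts are bottom-up merge sorts on
  \<open>O(|U| n)\<close> keys, and everything else takes linear time.
\<close>


section \<open>Structure of the follower's optimum: greedy packing by ratio\<close>

section \<open>Uniqueness of the follower's optimum\<close>

definition ahead_size :: "nat list \<Rightarrow> real list \<Rightarrow> nat \<Rightarrow> real" where
  "ahead_size a c i =
     (\<Sum>j | j < length a \<and> c ! i / real (a ! i) < c ! j / real (a ! j). real (a ! j))"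

text \<open>This is the only way optimality enters below: a feasible displacement \<open>h\<close>
  of an optimum cannot gain value. The structural lemmas apply it to displacements supported on one
  or two items.\<close>

lemma follower_optimal_perturb:
  assumes opt: "follower_optimal a b c x" and len: "length c = length a"
    and box: "\<And>k. k < length a \<Longrightarrow> x ! k + h k \<in> {0..1}"
    and cap: "dot (map real a) x + (\<Sum>k<length a. real (a ! k) * h k) \<le> b"
  shows "(\<Sum>k<length a. c ! k * h k) \<le> 0"
proof -
  define y where "y = map (\<lambda>k. x ! k + h k) [0..<length a]"
  have "dot (map real a) y = dot (map real a) x + (\<Sum>k<length a. real (a ! k) * h k)"
    by (simp add: dot_def y_def distrib_left sum.distrib)
  then have "follower_feasible a b y"
    using box cap by (simp add: follower_feasible_def y_def)
  then have "dot c y \<le> dot c x"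
    using opt by (auto simp: follower_optimal_def is_arg_max_linorder)
  moreover have "dot c y = dot c x + (\<Sum>k<length a. c ! k * h k)"
    by (simp add: dot_def y_def distrib_left sum.distrib len)
  ultimately show ?thesis by simp
qed

context
  fixes a :: "nat list" and b :: real and c x :: "real list"
  assumes opt: "follower_optimal a b c x"
    and len: "length c = length a"
    and size_pos: "\<And>i. i < length a \<Longrightarrow> 0 < a ! i"
begin

lemma follower_optimal_bounds:
  "i < length a \<Longrightarrow> 0 \<le> x ! i" "i < length a \<Longrightarrow> x ! i \<le> 1"
  "(\<Sum>i<length a. real (a ! i) * x ! i) \<le> b"
  using opt
  by (auto simp: follower_optimal_def is_arg_max_def follower_feasible_def dot_def)

lemma follower_optimal_negative:
  assumes i: "i < length a" and neg: "c ! i < 0"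
  shows "x ! i = 0"
proof -
  define h where "h k = (if k = i then - x ! i else 0)" for k
  have sum_h: "(\<Sum>k<length a. f k * h k) = - f i * x ! i" for f :: "nat \<Rightarrow> real"
    using i by (simp add: h_def mult_delta_right)
  have "(\<Sum>k<length a. c ! k * h k) \<le> 0"
  proof (rule follower_optimal_perturb[OF opt len])
    show "dot (map real a) x + (\<Sum>k<length a. real (a ! k) * h k) \<le> b"
      using follower_optimal_bounds(1)[OF i] follower_optimal_bounds(3)
      by (simp add: sum_h dot_def) (smt (verit) mult_nonneg_nonneg of_nat_0_le_iff)
  qed (use follower_optimal_bounds in \<open>auto simp: h_def\<close>)
  then have "0 \<le> c ! i * x ! i" by (simp add: sum_h)
  with neg follower_optimal_bounds(1)[OF i] show ?thesis
    by (smt (verit) mult_neg_pos)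
qed

lemma follower_optimal_fills_capacity:
  assumes i: "i < length a" and pos: "0 < c ! i" and slack: "x ! i < 1"
  shows "(\<Sum>i<length a. real (a ! i) * x ! i) = b"
proof (rule ccontr)
  assume "\<not> ?thesis"
  with follower_optimal_bounds(3) have less: "(\<Sum>i<length a. real (a ! i) * x ! i) < b" by simp
  define e where
    "e = min (1 - x ! i) ((b - (\<Sum>i<length a. real (a ! i) * x ! i)) / real (a ! i))"
  have a: "0 < real (a ! i)" using size_pos[OF i] by simp
  have e: "0 < e" "e \<le> 1 - x ! i"
    using less slack a by (auto simp: e_def)
  have "e \<le> (b - (\<Sum>i<length a. real (a ! i) * x ! i)) / real (a ! i)"
    by (simp add: e_def)
  then have e2: "real (a ! i) * e \<le> b - (\<Sum>i<length a. real (a ! i) * x ! i)"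
    using a by (simp add: pos_le_divide_eq mult.commute)
  define h where "h k = (if k = i then e else 0)" for k
  have sum_h: "(\<Sum>k<length a. f k * h k) = f i * e" for f :: "nat \<Rightarrow> real"
    using i by (simp add: h_def mult_delta_right)
  have "(\<Sum>k<length a. c ! k * h k) \<le> 0"
  proof (rule follower_optimal_perturb[OF opt len])
    show "dot (map real a) x + (\<Sum>k<length a. real (a ! k) * h k) \<le> b"
      using e2 by (simp add: sum_h dot_def)
    show "x ! k + h k \<in> {0..1}" if "k < length a" for k
      using e follower_optimal_bounds(1,2)[OF that] by (auto simp: h_def)
  qed
  then show False using e pos by (simp add: sum_h mult_le_0_iff)
qed

text \<open>Otherwise some capacity could be moved from item \<open>j\<close> to the item
  \<open>i\<close> of better ratio, at constant total size and with a strict gain.\<close>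

lemma follower_optimal_exchange:
  assumes i: "i < length a" and j: "j < length a"
    and ratio: "c ! j / real (a ! j) < c ! i / real (a ! i)" and pos: "0 < x ! j"
  shows "x ! i = 1"
proof (rule ccontr)
  assume "\<not> ?thesis"
  then have less: "x ! i < 1" using follower_optimal_bounds(2)[OF i] by simp
  have a: "0 < real (a ! i)" "0 < real (a ! j)" using size_pos i j by auto
  \<comment> \<open>The amount moved is measured in capacity, not in item fractions:
    \<open>x ! i\<close> grows by \<open>e / a ! i\<close> and \<open>x ! j\<close> shrinks by
    \<open>e / a ! j\<close>, so the used capacity stays fixed and the value changes by
    \<open>e\<close> times the difference of the ratios.\<close>
  define e where "e = min (real (a ! j) * x ! j) (real (a ! i) * (1 - x ! i))"
  have e: "0 < e" using a pos less by (simp add: e_def)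
  have "e \<le> real (a ! j) * x ! j" "e \<le> real (a ! i) * (1 - x ! i)" by (simp_all add: e_def)
  then have e2: "e / real (a ! j) \<le> x ! j" "e / real (a ! i) \<le> 1 - x ! i"
    using a by (simp_all add: pos_divide_le_eq mult.commute)
  define h where
    "h k = (if k = i then e / real (a ! i) else 0) - (if k = j then e / real (a ! j) else 0)" for k
  have sum_h: "(\<Sum>k<length a. f k * h k) = f i * (e / real (a ! i)) - f j * (e / real (a ! j))"
    for f :: "nat \<Rightarrow> real"
    using i j by (simp add: h_def right_diff_distrib sum_subtractf mult_delta_right)
  have "i \<noteq> j" using ratio by auto
  have "(\<Sum>k<length a. c ! k * h k) \<le> 0"
  proof (rule follower_optimal_perturb[OF opt len])
    show "dot (map real a) x + (\<Sum>k<length a. real (a ! k) * h k) \<le> b"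
      using a follower_optimal_bounds(3) by (simp add: sum_h dot_def)
    show "x ! k + h k \<in> {0..1}" if "k < length a" for k
    proof -
      have "0 \<le> e / real (a ! i)" "0 \<le> e / real (a ! j)" using e by simp_all
      with e2 \<open>i \<noteq> j\<close> follower_optimal_bounds(1,2)[OF that] show ?thesis
        unfolding h_def by (cases "k = i"; cases "k = j") (simp; linarith)+
    qed
  qed
  then have "e * (c ! i / real (a ! i) - c ! j / real (a ! j)) \<le> 0"
    unfolding sum_h by (simp add: algebra_simps)
  then show False using e ratio by (simp add: mult_le_0_iff)
qed

text \<open>For a profitable item the occupied capacity is \<open>b - ahead_size a c i\<close>
  clipped to the interval from 0 to \<open>a ! i\<close>, and such a clipping is a difference of two
  hinges. If the item is used at all, all items of larger ratio are full, which gives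
  \<open>upper\<close>; if it is not full, all items of smaller ratio are empty and the capacity is
  exhausted, which gives \<open>lower\<close>.\<close>

lemma follower_optimal_eq:
  assumes ties: "\<And>i j. i < length a \<Longrightarrow> j < length a \<Longrightarrow> i \<noteq> j \<Longrightarrow>
      c ! i / real (a ! i) \<noteq> c ! j / real (a ! j)"
    and i: "i < length a" and nz: "c ! i \<noteq> 0"
  shows "real (a ! i) * x ! i = (if 0 < c ! i
    then max 0 (b - ahead_size a c i) - max 0 (b - (ahead_size a c i + real (a ! i))) else 0)"
proof (cases "0 < c ! i")
  case False
  with nz follower_optimal_negative[OF i] show ?thesis by simp
next
  case True
  let ?J = "{j. j < length a \<and> c ! i / real (a ! i) < c ! j / real (a ! j)}"
  let ?K = "{j. j < length a \<and> c ! j / real (a ! j) < c ! i / real (a ! i)}"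
  have a: "0 < real (a ! i)" using size_pos[OF i] by simp
  \<comment> \<open>Since there are no ties, every other item has a strictly larger or a strictly
    smaller ratio.\<close>
  have "{..<length a} = insert i (?J \<union> ?K)" using i ties[OF i] by force
  then have split: "(\<Sum>j<length a. real (a ! j) * x ! j)
      = real (a ! i) * x ! i + ((\<Sum>j\<in>?J. real (a ! j) * x ! j) + (\<Sum>j\<in>?K. real (a ! j) * x ! j))"
    by (simp add: sum.union_disjoint[symmetric] disjoint_iff)
  have upper: "ahead_size a c i + real (a ! i) * x ! i \<le> b" if "0 < x ! i"
  proof -
    have "(\<Sum>j\<in>?J. real (a ! j) * x ! j) = ahead_size a c i"
      unfolding ahead_size_def using follower_optimal_exchange[OF _ i _ that]
      by (intro sum.cong) auto
    moreover have "0 \<le> (\<Sum>j\<in>?K. real (a ! j) * x ! j)"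
      by (intro sum_nonneg) (auto intro: mult_nonneg_nonneg follower_optimal_bounds)
    ultimately show ?thesis using split follower_optimal_bounds(3) by simp
  qed
  have lower: "b \<le> ahead_size a c i + real (a ! i) * x ! i" if "x ! i < 1"
  proof -
    have "(\<Sum>j\<in>?K. real (a ! j) * x ! j) = 0"
    proof (rule sum.neutral, safe)
      fix j assume "j < length a" "c ! j / real (a ! j) < c ! i / real (a ! i)"
      then have "x ! j = 0"
        using follower_optimal_exchange[of i j] follower_optimal_bounds(1)[of j] i that by force
      then show "real (a ! j) * x ! j = 0" by simp
    qed
    moreover have "(\<Sum>j\<in>?J. real (a ! j) * x ! j) \<le> ahead_size a c i"
      unfolding ahead_size_def
      by (intro sum_mono) (auto intro!: mult_left_le follower_optimal_bounds)
    ultimately show ?thesis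
      using split follower_optimal_fills_capacity[OF i True that] by simp
  qed
  consider "x ! i = 0" | "x ! i = 1" | "0 < x ! i" "x ! i < 1"
    using follower_optimal_bounds(1,2)[OF i] by linarith
  then show ?thesis
  proof cases
    case 3
    then have "real (a ! i) * x ! i < real (a ! i)" using a by simp
    moreover have "0 < real (a ! i) * x ! i" using 3 a by simp
    ultimately show ?thesis using 3 True upper lower by auto
  qed (use True a upper lower in auto)
qed

end


section \<open>Piecewise linear functions: maxima at breakpoints and evaluation in sorted
  order\<close>

section \<open>Sums of hinge functions\<close>

definition hinge_sum :: "(nat \<Rightarrow> real) \<Rightarrow> (nat \<Rightarrow> real) \<Rightarrow> nat \<Rightarrow> real \<Rightarrow> real \<Rightarrow> real" where
  "hinge_sum \<sigma> p M \<delta> b = (\<Sum>e<M. \<sigma> e * max 0 (b - p e)) - \<delta> * b"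

text \<open>No breakpoint lies strictly between \<open>l\<close> and \<open>h\<close>, so each hinge
  is either constantly zero or linear on that interval.\<close>

lemma hinge_sum_affine:
  assumes "\<And>e. e < M \<Longrightarrow> p e \<le> l \<or> h \<le> p e" and "l \<le> h" and t: "0 \<le> t" "t \<le> 1"
  shows "hinge_sum \<sigma> p M \<delta> ((1 - t) * l + t * h)
    = (1 - t) * hinge_sum \<sigma> p M \<delta> l + t * hinge_sum \<sigma> p M \<delta> h"
proof -
  let ?b = "(1 - t) * l + t * h"
  have b: "l \<le> ?b" "?b \<le> h"
    using assms(2) t convex_bound_le[of l h h "1 - t" t] convex_bound_le[of "-l" "-l" "-h" "1 - t" t]
    by auto
  have max_eq: "max 0 (?b - p e) = (1 - t) * max 0 (l - p e) + t * max 0 (h - p e)" if "e < M" for e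
  proof (cases "p e \<le> l")
    case True
    with b assms(2) show ?thesis by (simp add: max_def algebra_simps)
  next
    case False
    with assms(1)[OF that] have "h \<le> p e" by simp
    with b assms(2) show ?thesis by (simp add: max_def)
  qed
  have "(\<Sum>e<M. \<sigma> e * max 0 (?b - p e))
      = (\<Sum>e<M. (1 - t) * (\<sigma> e * max 0 (l - p e)) + t * (\<sigma> e * max 0 (h - p e)))"
    by (intro sum.cong refl, subst max_eq) (auto simp: algebra_simps)
  also have "\<dots> = (1 - t) * (\<Sum>e<M. \<sigma> e * max 0 (l - p e)) + t * (\<Sum>e<M. \<sigma> e * max 0 (h - p e))"
    by (simp add: sum.distrib sum_distrib_left)
  finally show ?thesis unfolding hinge_sum_def by (simp add: algebra_simps)
qed

text \<open>The value at \<open>b\<close> is a convex combination of the values at the nearest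
  breakpoints on either side, both of which lie in the range.\<close>

lemma hinge_sum_le_breakpoints:
  assumes lo: "elo < M" "p elo = lo" and hi: "ehi < M" "p ehi = hi" and b: "lo \<le> b" "b \<le> hi"
    and bound: "\<And>e. e < M \<Longrightarrow> p e \<in> {lo..hi} \<Longrightarrow> hinge_sum \<sigma> p M \<delta> (p e) \<le> v"
  shows "hinge_sum \<sigma> p M \<delta> b \<le> v"
proof -
  \<comment> \<open>Requiring the ends \<open>lo\<close> and \<open>hi\<close> to be breakpoints
    themselves makes both sets nonempty and keeps the two neighbours of \<open>b\<close> within the
    range.\<close>
  define L where "L = p ` {e. e < M \<and> p e \<le> b}"
  define H where "H = p ` {e. e < M \<and> b \<le> p e}"
  have fin: "finite L" "finite H" by (auto simp: L_def H_def)
  have mem: "lo \<in> L" "hi \<in> H" using lo hi b by (auto simp: L_def H_def)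
  have L: "Max L \<in> L" "lo \<le> Max L" and H: "Min H \<in> H" "Min H \<le> hi"
    using fin mem by (auto intro: Max_in Min_in)
  have le: "Max L \<le> b" "b \<le> Min H" using L H by (auto simp: L_def H_def)
  have vL: "hinge_sum \<sigma> p M \<delta> (Max L) \<le> v"
    using L le b bound by (auto simp: L_def)
  have vH: "hinge_sum \<sigma> p M \<delta> (Min H) \<le> v"
    using H le b bound by (auto simp: H_def)
  show ?thesis
  proof (cases "Max L = Min H")
    case True
    with le have "b = Max L" by simp
    with vL show ?thesis by simp
  next
    case False
    define t where "t = (b - Max L) / (Min H - Max L)"
    have d: "0 < Min H - Max L" using False le by simp
    have t: "0 \<le> t" "t \<le> 1" using le d by (auto simp: t_def pos_divide_le_eq)
    have "t * (Min H - Max L) = b - Max L" using d by (simp add: t_def)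
    then have "b = (1 - t) * Max L + t * Min H" by (simp add: algebra_simps)
    moreover have "p e \<le> Max L \<or> Min H \<le> p e" if "e < M" for e
      using that fin Max_ge[of L "p e"] Min_le[of H "p e"]
      by (cases "p e \<le> b") (auto simp: L_def H_def)
    ultimately have "hinge_sum \<sigma> p M \<delta> b
        = (1 - t) * hinge_sum \<sigma> p M \<delta> (Max L) + t * hinge_sum \<sigma> p M \<delta> (Min H)"
      using hinge_sum_affine[of M p "Max L" "Min H" t] t d by simp
    also have "\<dots> \<le> v" using vL vH t by (intro convex_bound_le) auto
    finally show ?thesis .
  qed
qed

text \<open>Events from rank \<open>t\<close> on have zero hinge at the position of rank
  \<open>t\<close>, and earlier ones have a linear hinge. The order among equal positions is
  immaterial, because their hinges vanish. Two prefix sums therefore suffice to evaluate the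
  objective at every event.\<close>

lemma hinge_sum_sorted:
  assumes bij: "bij_betw \<pi> {..<M} {..<M}"
    and srt: "\<And>x y. x \<le> y \<Longrightarrow> y < M \<Longrightarrow> p (\<pi> x) \<le> p (\<pi> y)" and t: "t < M"
  shows "hinge_sum \<sigma> p M \<delta> (p (\<pi> t))
    = ((\<Sum>e<t. \<sigma> (\<pi> e)) - \<delta>) * p (\<pi> t) - (\<Sum>e<t. \<sigma> (\<pi> e) * p (\<pi> e))"
proof -
  let ?y = "p (\<pi> t)"
  have "(\<Sum>e<M. \<sigma> e * max 0 (?y - p e)) = (\<Sum>e<M. \<sigma> (\<pi> e) * max 0 (?y - p (\<pi> e)))"
    by (rule sum.reindex_bij_betw[OF bij, symmetric])
  also have "\<dots> = (\<Sum>e<t. \<sigma> (\<pi> e) * max 0 (?y - p (\<pi> e)))"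
  proof (rule sum.mono_neutral_right)
    show "\<forall>e\<in>{..<M} - {..<t}. \<sigma> (\<pi> e) * max 0 (?y - p (\<pi> e)) = 0"
    proof
      fix e assume "e \<in> {..<M} - {..<t}"
      then have "?y \<le> p (\<pi> e)" by (intro srt) auto
      then show "\<sigma> (\<pi> e) * max 0 (?y - p (\<pi> e)) = 0" by simp
    qed
  qed (use t in auto)
  also have "\<dots> = (\<Sum>e<t. \<sigma> (\<pi> e) * ?y - \<sigma> (\<pi> e) * p (\<pi> e))"
    using srt t by (intro sum.cong) (auto simp: max_def algebra_simps)
  also have "\<dots> = (\<Sum>e<t. \<sigma> (\<pi> e)) * ?y - (\<Sum>e<t. \<sigma> (\<pi> e) * p (\<pi> e))"
    by (simp add: sum_subtractf sum_distrib_right)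
  finally show ?thesis by (simp add: hinge_sum_def algebra_simps)
qed


section \<open>Rules for total correctness with time bounds\<close>

section \<open>Execution within a time bound\<close>

text \<open>Total correctness from a fixed start memory. The time is only bounded from above, so
  that branches of different cost share one bound and sequential bounds add up.\<close>

definition terminates :: "com \<Rightarrow> ram \<Rightarrow> nat \<Rightarrow> (ram \<Rightarrow> bool) \<Rightarrow> bool" where
  "terminates p s t Q \<longleftrightarrow> (\<exists>t' s'. exec p s t' s' \<and> t' \<le> t \<and> Q s')"

lemma terminates_Seq:
  assumes "terminates p s t R" and "\<And>s'. R s' \<Longrightarrow> terminates q s' u Q"
  shows "terminates (Seq p q) s (t + u) Q"
  using assms unfolding terminates_def by (meson exec.Seq add_mono)

lemma terminates_mono:
  assumes "terminates p s t R" and "t \<le> u" and "\<And>s'. R s' \<Longrightarrow> Q s'"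
  shows "terminates p s u Q"
  using assms unfolding terminates_def by (meson order_trans)

text \<open>The number \<open>r\<close> of rounds is known in advance and the invariant is indexed
  by the round. The final summand pays for the failing test.\<close>

lemma terminates_While:
  assumes step: "\<And>k s. k < r \<Longrightarrow> Inv k s \<Longrightarrow> beval s g \<and> terminates p s t (Inv (Suc k))"
    and exit: "\<And>s. Inv r s \<Longrightarrow> \<not> beval s g"
    and init: "Inv 0 s"
  shows "terminates (While g p) s (r * (1 + bcost g + t) + (1 + bcost g)) (Inv r)"
proof -
  have "terminates (While g p) s ((r - k) * (1 + bcost g + t) + (1 + bcost g)) (Inv r)"
    if "k \<le> r" "Inv k s" for k s
    using that
  proof (induction "r - k" arbitrary: k s)
    case 0
    then have "exec (While g p) s (1 + bcost g) s" using exit WhileFalse[of s g p] by simp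
    with 0 show ?case unfolding terminates_def by auto
  next
    case (Suc d)
    then have k: "k < r" by simp
    from step[OF this Suc.prems(2)] obtain t' s' where
      g: "beval s g" and p: "exec p s t' s'" "t' \<le> t" and s': "Inv (Suc k) s'"
      unfolding terminates_def by auto
    have "terminates (While g p) s' ((r - Suc k) * (1 + bcost g + t) + (1 + bcost g)) (Inv r)"
      using Suc.hyps(1)[of "Suc k" s'] Suc.hyps(2) s' k by simp
    then obtain u s'' where w: "exec (While g p) s' u s''"
      "u \<le> (r - Suc k) * (1 + bcost g + t) + (1 + bcost g)" and s'': "Inv r s''"
      unfolding terminates_def by auto
    have "r - k = Suc (r - Suc k)" using k by simp
    then have "1 + bcost g + t' + u \<le> (r - k) * (1 + bcost g + t) + (1 + bcost g)"
      using p w by simp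
    with WhileTrue[OF g p(1) w(1)] s'' show ?case unfolding terminates_def by blast
  qed
  from this[of 0 s] init show ?thesis by simp
qed

section \<open>Loop-free programs\<close>

primrec straight_line :: "com \<Rightarrow> bool" where
  "straight_line Skip \<longleftrightarrow> True"
| "straight_line (IPut x i e) \<longleftrightarrow> True"
| "straight_line (RPut x i e) \<longleftrightarrow> True"
| "straight_line (Seq p q) \<longleftrightarrow> straight_line p \<and> straight_line q"
| "straight_line (Cond b p q) \<longleftrightarrow> straight_line p \<and> straight_line q"
| "straight_line (While b p) \<longleftrightarrow> False"

text \<open>Loop-free programs get a functional semantics, so that the effect of a loop body is
  computed by simplification. The clauses of \<open>run\<close> and \<open>cost\<close> for
  \<open>While\<close> are default values, excluded by the hypothesis of
  \<open>exec_run\<close>.\<close>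

primrec run :: "com \<Rightarrow> ram \<Rightarrow> ram" where
  "run Skip s = s"
| "run (IPut x i e) s = s\<lparr>imem := (imem s)(x := (imem s x)(ieval s i := ieval s e))\<rparr>"
| "run (RPut x i e) s = s\<lparr>rmem := (rmem s)(x := (rmem s x)(ieval s i := reval s e))\<rparr>"
| "run (Seq p q) s = run q (run p s)"
| "run (Cond b p q) s = (if beval s b then run p s else run q s)"
| "run (While b p) s = s"

primrec cost :: "com \<Rightarrow> nat" where
  "cost Skip = 1"
| "cost (IPut x i e) = 1 + icost i + icost e"
| "cost (RPut x i e) = 1 + icost i + rcost e"
| "cost (Seq p q) = cost p + cost q"
| "cost (Cond b p q) = 1 + bcost b + max (cost p) (cost q)"
| "cost (While b p) = 0"

lemma exec_run: "straight_line p \<Longrightarrow> \<exists>t \<le> cost p. exec p s t (run p s)"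
proof (induction p arbitrary: s)
  case (Seq p q)
  then obtain t u where "t \<le> cost p" "exec p s t (run p s)"
    and "u \<le> cost q" "exec q (run p s) u (run q (run p s))"
    by (meson straight_line.simps(4))
  then show ?case by (auto intro!: exI[of _ "t + u"] exec.Seq)
next
  case (Cond b p q)
  then obtain t u where tu: "t \<le> cost p" "exec p s t (run p s)" "u \<le> cost q" "exec q s u (run q s)"
    by (meson straight_line.simps(5))
  show ?case
  proof (cases "beval s b")
    case True
    with tu CondTrue[OF True tu(2), of q] show ?thesis
      by (auto intro!: exI[of _ "1 + bcost b + t"])
  next
    case False
    with tu CondFalse[OF False tu(4), of p] show ?thesis
      by (auto intro!: exI[of _ "1 + bcost b + u"])
  qed
qed (auto intro: exec.intros simp del: One_nat_def simp: exec.Skip)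

lemma terminates_run: "straight_line p \<Longrightarrow> Q (run p s) \<Longrightarrow> terminates p s (cost p) Q"
  using exec_run[of p s] unfolding terminates_def by blast

section \<open>Frame conditions from the names a program may write\<close>

primrec iwrites :: "com \<Rightarrow> name set" where
  "iwrites Skip = {}"
| "iwrites (IPut x i e) = {x}"
| "iwrites (RPut x i e) = {}"
| "iwrites (Seq p q) = iwrites p \<union> iwrites q"
| "iwrites (Cond b p q) = iwrites p \<union> iwrites q"
| "iwrites (While b p) = iwrites p"

primrec rwrites :: "com \<Rightarrow> name set" where
  "rwrites Skip = {}"
| "rwrites (IPut x i e) = {}"
| "rwrites (RPut x i e) = {x}"
| "rwrites (Seq p q) = rwrites p \<union> rwrites q"
| "rwrites (Cond b p q) = rwrites p \<union> rwrites q"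
| "rwrites (While b p) = rwrites p"

definition unchanged :: "com \<Rightarrow> ram \<Rightarrow> ram \<Rightarrow> bool" where
  "unchanged p s s' \<longleftrightarrow>
     (\<forall>x. x \<notin> iwrites p \<longrightarrow> imem s' x = imem s x) \<and> (\<forall>x. x \<notin> rwrites p \<longrightarrow> rmem s' x = rmem s x)"

lemma exec_unchanged: "exec p s t s' \<Longrightarrow> unchanged p s s'"
  by (induction rule: exec.induct) (auto simp: unchanged_def)

text \<open>Lets the contract of each phase mention only what the phase computes; preservation of
  all other arrays follows from the program text.\<close>

lemma terminates_frame: "terminates p s t Q \<Longrightarrow> terminates p s t (\<lambda>s'. Q s' \<and> unchanged p s s')"
  unfolding terminates_def using exec_unchanged by blast


abbreviation ivar :: "name \<Rightarrow> iexp" where "ivar x \<equiv> IGet x (IConst 0)"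
abbreviation rvar :: "name \<Rightarrow> rexp" where "rvar x \<equiv> RGet x (IConst 0)"
abbreviation iset :: "name \<Rightarrow> iexp \<Rightarrow> com" where "iset x \<equiv> IPut x (IConst 0)"
abbreviation rset :: "name \<Rightarrow> rexp \<Rightarrow> com" where "rset x \<equiv> RPut x (IConst 0)"
abbreviation inc :: "name \<Rightarrow> com" where "inc x \<equiv> iset x (IAdd (ivar x) (IConst 1))"

definition for_loop :: "name \<Rightarrow> name \<Rightarrow> com \<Rightarrow> com" where
  "for_loop x y p =
     Seq (iset x (IConst 0)) (While (ILess (ivar x) (ivar y)) (Seq p (inc x)))"

lemma writes_for_loop [simp]:
  "iwrites (for_loop x y p) = insert x (iwrites p)" "rwrites (for_loop x y p) = rwrites p"
  by (auto simp: for_loop_def)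

text \<open>Besides the body, each round costs 12 operations: 6 for the test and 6 for the
  increment. The 9 further operations are 3 for the initial assignment and 6 for the last
  test.\<close>

lemma terminates_for:
  assumes p: "straight_line p" and x: "x \<notin> iwrites p" and y: "y \<notin> iwrites p" "x \<noteq> y"
    and M: "imem s y 0 = M" and time: "M * (12 + cost p) + 9 \<le> t"
    and init: "Inv 0 (run (iset x (IConst 0)) s)"
    and step: "\<And>k s. k < M \<Longrightarrow> imem s x 0 = k \<Longrightarrow> imem s y 0 = M \<Longrightarrow> Inv k s \<Longrightarrow>
      Inv (Suc k) (run (Seq p (inc x)) s)"
  shows "terminates (for_loop x y p) s t (Inv M)"
proof (rule terminates_mono)
  \<comment> \<open>The facts on counter and bound are carried here once; they persist because the
    body writes neither name.\<close>
  let ?inv = "\<lambda>k s. Inv k s \<and> imem s x 0 = k \<and> imem s y 0 = M"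
  let ?g = "ILess (ivar x) (ivar y)" and ?body = "Seq p (inc x)"
  show "terminates (for_loop x y p) s (cost (iset x (IConst 0)) +
      (M * (1 + bcost ?g + cost ?body) + (1 + bcost ?g))) (?inv M)"
    unfolding for_loop_def
  proof (intro terminates_Seq[where R = "?inv 0"] terminates_run terminates_While[where Inv = ?inv])
    show "?inv 0 (run (iset x (IConst 0)) s)" using init M y by simp
  next
    fix k s assume k: "k < M" "?inv k s"
    have "unchanged p s (run p s)" using exec_run[OF p] exec_unchanged by blast
    with k x y have "imem (run ?body s) x 0 = Suc k" "imem (run ?body s) y 0 = M"
      by (auto simp: unchanged_def)
    with k p step[of k s] show "beval s ?g \<and> terminates ?body s (cost ?body) (?inv (Suc k))"
      by (intro conjI terminates_run) simp_all
  qed auto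
qed (use time in \<open>simp_all add: algebra_simps\<close>)

text \<open>Truncated subtraction makes \<open>x - (x - y)\<close> the minimum of \<open>x\<close> and \<open>y\<close>.\<close>

definition imin :: "iexp \<Rightarrow> iexp \<Rightarrow> iexp" where
  "imin e f = ISub e (ISub e f)"

lemma ieval_imin [simp]: "ieval s (imin e f) = min (ieval s e) (ieval s f)"
  by (simp add: imin_def)


section \<open>Bottom-up merge sort of an index array\<close>

section \<open>Merge sort\<close>

definition identity_loop :: "name \<Rightarrow> com" where
  "identity_loop E = for_loop ''q'' E (IPut ''ord'' (ivar ''q'') (ivar ''q''))"

text \<open>Opens the next two adjacent runs, starting where the previous pair ended. Clipping at
  the array length covers a short or empty run at the end.\<close>

definition open_block :: "name \<Rightarrow> com" where
  "open_block E =
     Seq (iset ''left'' (ivar ''hi''))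
    (Seq (iset ''mid'' (imin (IAdd (ivar ''hi'') (ivar ''width'')) (ivar E)))
    (Seq (iset ''right'' (ivar ''mid''))
         (iset ''hi'' (imin (IAdd (ivar ''mid'') (ivar ''width'')) (ivar E)))))"

definition merge_step :: "name \<Rightarrow> com" where
  "merge_step K =
     Cond (BAnd (ILess (ivar ''left'') (ivar ''mid''))
                 (BNot (BAnd (ILess (ivar ''right'') (ivar ''hi''))
                   (RLess (RGet K (IGet ''ord'' (ivar ''right''))) (RGet K (IGet ''ord'' (ivar ''left'')))))))
            (Seq (IPut ''tmp'' (ivar ''q'') (IGet ''ord'' (ivar ''left''))) (inc ''left''))
            (Seq (IPut ''tmp'' (ivar ''q'') (IGet ''ord'' (ivar ''right''))) (inc ''right''))"

text \<open>A single loop over the output positions replaces nested loops over blocks and their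
  entries: a new block is opened whenever the current one is exhausted. The body is thus loop-free,
  and the linear time of a pass is immediate.\<close>

definition merge_pass :: "name \<Rightarrow> name \<Rightarrow> com" where
  "merge_pass K E =
     Seq (Seq (iset ''hi'' (IConst 0)) (open_block E))
         (for_loop ''q'' E
           (Seq (Cond (ILess (ivar ''q'') (ivar ''hi'')) Skip (open_block E)) (merge_step K)))"

definition copy_loop :: "name \<Rightarrow> com" where
  "copy_loop E = for_loop ''q'' E (IPut ''ord'' (ivar ''q'') (IGet ''tmp'' (ivar ''q'')))"

text \<open>Only the index array \<open>ord\<close> is rearranged. The keys stay in place, so all
  other arrays remain addressed by the original numbers.\<close>

definition merge_sort :: "name \<Rightarrow> name \<Rightarrow> com" where
  "merge_sort K E = Seq (identity_loop E) (Seq (iset ''width'' (IConst 1))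
     (While (ILess (ivar ''width'') (ivar E))
       (Seq (merge_pass K E) (Seq (copy_loop E)
         (iset ''width'' (IAdd (ivar ''width'') (ivar ''width'')))))))"

lemmas merge_sort_defs =
  identity_loop_def open_block_def merge_step_def merge_pass_def copy_loop_def merge_sort_def

text \<open>Aligned blocks of length \<open>w\<close> are identified by the quotient of the position
  by \<open>w\<close>. For \<open>w = 1\<close> the condition is trivial, and for \<open>w\<close>
  at least \<open>E\<close> it says that the whole array is sorted.\<close>

definition sorted_blocks :: "(nat \<Rightarrow> real) \<Rightarrow> nat \<Rightarrow> nat \<Rightarrow> (nat \<Rightarrow> nat) \<Rightarrow> bool" where
  "sorted_blocks \<kappa> w E A \<longleftrightarrow>
     (\<forall>x y. x \<le> y \<and> y < E \<and> x div w = y div w \<longrightarrow> \<kappa> (A x) \<le> \<kappa> (A y))"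

text \<open>
  Invariant of a merge pass from \<open>A\<close> to \<open>B\<close>: the block \<open>{lo..<hi}\<close> is being merged, \<open>i\<close> and \<open>j\<close>
  are the next positions in its two halves, and \<open>k\<close> is the next output position.
\<close>

definition merge_inv :: "(nat \<Rightarrow> real) \<Rightarrow> nat \<Rightarrow> nat \<Rightarrow> (nat \<Rightarrow> nat) \<Rightarrow> (nat \<Rightarrow> nat) \<Rightarrow>
    nat \<Rightarrow> nat \<Rightarrow> nat \<Rightarrow> nat \<Rightarrow> nat \<Rightarrow> nat \<Rightarrow> bool" where
  "merge_inv \<kappa> w E A B lo i mid j hi k \<longleftrightarrow>
     2 * w dvd lo \<and> mid = min (lo + w) E \<and> hi = min (lo + 2 * w) E \<and>
     lo \<le> i \<and> i \<le> mid \<and> mid \<le> j \<and> j \<le> hi \<and> k + mid = i + j \<and>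
     B ` {..<k} = A ` ({..<i} \<union> {mid..<j}) \<and>
     sorted_blocks \<kappa> (2 * w) k B \<and>
     (\<forall>x y. lo \<le> x \<and> x < k \<and> (i \<le> y \<and> y < mid \<or> j \<le> y \<and> y < hi) \<longrightarrow> \<kappa> (B x) \<le> \<kappa> (A y))"

lemma merge_inv_init:
  "merge_inv \<kappa> w E A B 0 0 (min w E) (min w E) (min (min w E + w) E) 0"
  by (auto simp: merge_inv_def sorted_blocks_def)

text \<open>At \<open>k = hi\<close> both runs are used up. As \<open>k < E\<close>, the block was
  not clipped, so the next one starts at the multiple \<open>lo + 2 * w\<close> of
  \<open>2 * w\<close>, and the clause comparing output with pending entries becomes
  vacuous.\<close>

lemma merge_inv_open:
  assumes "merge_inv \<kappa> w E A B lo i mid j hi k" and "k < E" "\<not> k < hi"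
  shows "merge_inv \<kappa> w E A B hi hi (min (hi + w) E) (min (hi + w) E)
    (min (min (hi + w) E + w) E) k"
proof -
  have k: "k = hi" "i = mid" "j = hi" using assms by (auto simp: merge_inv_def)
  have hi: "hi = lo + 2 * w" using assms k by (auto simp: merge_inv_def)
  have "{..<i} \<union> {mid..<j} = {..<hi}" "mid \<le> hi" using assms(1) k by (auto simp: merge_inv_def)
  with assms k hi show ?thesis by (auto simp: merge_inv_def)
qed

text \<open>All outputs in the block of \<open>k\<close> have positions from \<open>lo\<close> on,
  and the invariant bounds their keys by those of all pending entries, in particular by the key of
  the entry appended.\<close>

lemma merge_inv_take:
  fixes lo w k hi :: nat
  assumes inv: "merge_inv \<kappa> w E A B lo i mid j hi k" and k: "k < hi" "lo \<le> k"
    and y: "i \<le> y \<and> y < mid \<or> j \<le> y \<and> y < hi"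
  shows "sorted_blocks \<kappa> (2 * w) (Suc k) (B(k := A y))"
proof -
  have "\<kappa> (B x) \<le> \<kappa> (A y)" if "x < k" "x div (2 * w) = k div (2 * w)" for x
  proof -
    have hi: "hi \<le> lo + 2 * w" using inv by (simp add: merge_inv_def)
    from inv obtain q where q: "lo = 2 * w * q" unfolding merge_inv_def by (blast elim: dvdE)
    have w: "0 < 2 * w" using hi k by auto
    have "k div (2 * w) = q"
      using k hi w q by (intro div_nat_eqI) (auto simp: algebra_simps)
    with that w have "q = x div (2 * w)" by simp
    with q have "lo \<le> x" by simp
    with that y inv show ?thesis unfolding merge_inv_def by blast
  qed
  with inv show ?thesis
    unfolding merge_inv_def sorted_blocks_def by (auto simp: less_Suc_eq)
qed

lemma same_block:
  fixes w l x y :: nat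
  assumes "w dvd l" "l \<le> x" "x < l + w" "l \<le> y" "y < l + w"
  shows "x div w = y div w"
proof -
  from assms obtain q where q: "l = w * q" by auto
  have "x div w = q" "y div w = q"
    using assms q by (auto intro!: div_nat_eqI simp: algebra_simps)
  then show ?thesis by simp
qed

lemma sorted_blocksD:
  assumes "sorted_blocks \<kappa> w E A" "w dvd l" "l \<le> x" "x \<le> y" "y < l + w" "y < E"
  shows "\<kappa> (A x) \<le> \<kappa> (A y)"
  using assms same_block[of w l x y] unfolding sorted_blocks_def by simp

text \<open>The entry taken is minimal among the pending ones: in its own run by sortedness, in the
  other run by comparison with that run's head. \<open>merge_inv_right\<close> is the mirror
  image.\<close>

lemma merge_inv_left:
  assumes inv: "merge_inv \<kappa> w E A B lo i mid j hi k" and A: "sorted_blocks \<kappa> w E A"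
    and i: "i < mid" and le: "j < hi \<Longrightarrow> \<kappa> (A i) \<le> \<kappa> (A j)"
  shows "merge_inv \<kappa> w E A (B(k := A i)) lo (Suc i) mid j hi (Suc k)"
proof -
  note I = inv[unfolded merge_inv_def]
  have lo: "w dvd lo" "w dvd lo + w" using I by (auto intro: dvd_mult_right dvd_add)
  have "k < hi" "lo \<le> k" using I i by auto
  then have srt: "sorted_blocks \<kappa> (2 * w) (Suc k) (B(k := A i))"
    using merge_inv_take[OF inv, of i] i by simp
  have img: "(B(k := A i)) ` {..<Suc k} = A ` ({..<Suc i} \<union> {mid..<j})"
    using I by (auto simp: lessThan_Suc)
  have left: "\<kappa> (A i) \<le> \<kappa> (A y)" if "i \<le> y" "y < mid" for y
    using sorted_blocksD[OF A lo(1), of i y] that I by auto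
  have right: "\<kappa> (A i) \<le> \<kappa> (A y)" if "j \<le> y" "y < hi" for y
    using sorted_blocksD[OF A lo(2), of j y] le that I by (force intro: order_trans)
  have "\<kappa> ((B(k := A i)) x) \<le> \<kappa> (A y)"
    if "lo \<le> x" "x < Suc k" "Suc i \<le> y \<and> y < mid \<or> j \<le> y \<and> y < hi" for x y
  proof (cases "x = k")
    case True
    then show ?thesis using that left[of y] right[of y] by auto
  next
    case False
    have "i \<le> y \<and> y < mid \<or> j \<le> y \<and> y < hi" using that by auto
    moreover have "x < k" using that False by simp
    ultimately have "\<kappa> (B x) \<le> \<kappa> (A y)" using I that(1) by blast
    with False show ?thesis by simp
  qed
  with I i srt img show ?thesis unfolding merge_inv_def by auto
qed

lemma merge_inv_right:
  assumes inv: "merge_inv \<kappa> w E A B lo i mid j hi k" and A: "sorted_blocks \<kappa> w E A"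
    and j: "j < hi" and le: "i < mid \<Longrightarrow> \<kappa> (A j) \<le> \<kappa> (A i)"
  shows "merge_inv \<kappa> w E A (B(k := A j)) lo i mid (Suc j) hi (Suc k)"
proof -
  note I = inv[unfolded merge_inv_def]
  have lo: "w dvd lo" "w dvd lo + w" using I by (auto intro: dvd_mult_right dvd_add)
  have "k < hi" "lo \<le> k" using I j by auto
  then have srt: "sorted_blocks \<kappa> (2 * w) (Suc k) (B(k := A j))"
    using merge_inv_take[OF inv, of j] j by simp
  have "{mid..<Suc j} = insert j {mid..<j}" using I by auto
  then have img: "(B(k := A j)) ` {..<Suc k} = A ` ({..<i} \<union> {mid..<Suc j})"
    using I by (auto simp: lessThan_Suc)
  have left: "\<kappa> (A j) \<le> \<kappa> (A y)" if "i \<le> y" "y < mid" for y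
    using sorted_blocksD[OF A lo(1), of i y] le that I by (force intro: order_trans)
  have right: "\<kappa> (A j) \<le> \<kappa> (A y)" if "j \<le> y" "y < hi" for y
    using sorted_blocksD[OF A lo(2), of j y] that I by force
  have "\<kappa> ((B(k := A j)) x) \<le> \<kappa> (A y)"
    if "lo \<le> x" "x < Suc k" "i \<le> y \<and> y < mid \<or> Suc j \<le> y \<and> y < hi" for x y
  proof (cases "x = k")
    case True
    then show ?thesis using that left[of y] right[of y] by auto
  next
    case False
    have "i \<le> y \<and> y < mid \<or> j \<le> y \<and> y < hi" using that by auto
    moreover have "x < k" using that False by simp
    ultimately have "\<kappa> (B x) \<le> \<kappa> (A y)" using I that(1) by blast
    with False show ?thesis by simp
  qed
  with I j srt img show ?thesis unfolding merge_inv_def by auto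
qed

lemma merge_inv_final:
  assumes "merge_inv \<kappa> w E A B lo i mid j hi E"
  shows "B ` {..<E} = A ` {..<E}" "sorted_blocks \<kappa> (2 * w) E B"
proof -
  have "{..<i} \<union> {mid..<j} = {..<E}" using assms by (auto simp: merge_inv_def)
  with assms show "B ` {..<E} = A ` {..<E}" "sorted_blocks \<kappa> (2 * w) E B"
    by (auto simp: merge_inv_def)
qed

section \<open>Correctness and running time of the sorting program\<close>

definition sort_names :: "name set" where
  "sort_names = {''q'', ''ord'', ''tmp'', ''width'', ''left'', ''mid'', ''right'', ''hi''}"

definition pass_state :: "name \<Rightarrow> name \<Rightarrow> (nat \<Rightarrow> real) \<Rightarrow> nat \<Rightarrow> nat \<Rightarrow> (nat \<Rightarrow> nat) \<Rightarrow> nat \<Rightarrow> ram \<Rightarrow> bool" where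
  "pass_state K E \<kappa> M w A k s \<longleftrightarrow>
     rmem s K = \<kappa> \<and> imem s E 0 = M \<and> imem s ''width'' 0 = w \<and> imem s ''ord'' = A \<and>
     (\<exists>lo. merge_inv \<kappa> w M A (imem s ''tmp'') lo (imem s ''left'' 0) (imem s ''mid'' 0)
        (imem s ''right'' 0) (imem s ''hi'' 0) k)"

lemma pass_state_open:
  assumes "pass_state K E \<kappa> M w A k s" and "k < M" and "imem s ''q'' 0 = k"
    and "E \<notin> sort_names" and "0 < w"
  defines "s' \<equiv> run (Cond (ILess (ivar ''q'') (ivar ''hi'')) Skip (open_block E)) s"
  shows "pass_state K E \<kappa> M w A k s'" "k < imem s' ''hi'' 0" "imem s' ''q'' 0 = k"
proof -
  from assms obtain lo where lo: "merge_inv \<kappa> w M A (imem s ''tmp'') lo (imem s ''left'' 0)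
    (imem s ''mid'' 0) (imem s ''right'' 0) (imem s ''hi'' 0) k"
    by (auto simp: pass_state_def)
  show "pass_state K E \<kappa> M w A k s'"
    using assms lo merge_inv_open[OF lo assms(2)]
    by (auto simp: pass_state_def open_block_def sort_names_def)
  have "k = imem s ''hi'' 0" if "\<not> k < imem s ''hi'' 0"
    using lo that by (auto simp: merge_inv_def)
  then show "k < imem s' ''hi'' 0"
    using assms by (auto simp: pass_state_def open_block_def sort_names_def)
  show "imem s' ''q'' 0 = k"
    using assms by (auto simp: open_block_def)
qed

lemma pass_state_merge:
  assumes s: "pass_state K E \<kappa> M w A k s" and hi: "k < imem s ''hi'' 0" and q: "imem s ''q'' 0 = k"
    and E: "E \<notin> sort_names" and A: "sorted_blocks \<kappa> w M A"
  shows "pass_state K E \<kappa> M w A (Suc k) (run (Seq (merge_step K) (inc ''q'')) s)"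
proof -
  from s obtain lo where lo: "merge_inv \<kappa> w M A (imem s ''tmp'') lo (imem s ''left'' 0)
    (imem s ''mid'' 0) (imem s ''right'' 0) (imem s ''hi'' 0) k"
    by (auto simp: pass_state_def)
  \<comment> \<open>The second branch is also taken when the left run is exhausted; then
    \<open>k < hi\<close> guarantees that the right run still has an entry.\<close>
  have right: "imem s ''right'' 0 < imem s ''hi'' 0" if "\<not> imem s ''left'' 0 < imem s ''mid'' 0"
    using lo hi that by (auto simp: merge_inv_def)
  show ?thesis
    using s E q merge_inv_left[OF lo A] merge_inv_right[OF lo A] right
    by (auto simp: pass_state_def merge_step_def sort_names_def not_less intro: less_imp_le)
qed

lemma merge_pass_terminates:
  assumes E: "E \<notin> sort_names" and w: "0 < w" and A: "sorted_blocks \<kappa> w M A"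
    and s: "rmem s K = \<kappa>" "imem s E 0 = M" "imem s ''width'' 0 = w" "imem s ''ord'' = A"
  shows "terminates (merge_pass K E) s (100 * M + 100) (pass_state K E \<kappa> M w A M)"
  unfolding merge_pass_def
proof (rule terminates_mono)
  let ?init = "Seq (iset ''hi'' (IConst 0)) (open_block E)"
  let ?body = "Seq (Cond (ILess (ivar ''q'') (ivar ''hi'')) Skip (open_block E)) (merge_step K)"
  have init: "pass_state K E \<kappa> M w A 0 (run ?init s)"
    using E s merge_inv_init[of \<kappa> w M A]
    by (auto simp: pass_state_def open_block_def sort_names_def)
  show "terminates (Seq ?init (for_loop ''q'' E ?body)) s (cost ?init + (100 * M + 10))
      (pass_state K E \<kappa> M w A M)"
  proof (rule terminates_Seq[OF terminates_run[where Q = "pass_state K E \<kappa> M w A 0", OF _ init]])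
    fix s assume s: "pass_state K E \<kappa> M w A 0 s"
    show "terminates (for_loop ''q'' E ?body) s (100 * M + 10) (pass_state K E \<kappa> M w A M)"
    proof (rule terminates_for[where Inv = "pass_state K E \<kappa> M w A"])
      fix k s assume "k < M" "imem s ''q'' 0 = k" "pass_state K E \<kappa> M w A k s"
      from pass_state_merge[OF pass_state_open[OF this(3,1,2) E w] E A]
      show "pass_state K E \<kappa> M w A (Suc k) (run (Seq ?body (inc ''q'')) s)" by simp
    qed (use s E in \<open>auto simp: pass_state_def open_block_def merge_step_def imin_def sort_names_def\<close>)
  qed (simp add: open_block_def)
qed (auto simp: open_block_def imin_def)

lemma identity_loop_terminates:
  assumes "E \<notin> sort_names" and "imem s E 0 = M"
  shows "terminates (identity_loop E) s (20 * M + 20) (\<lambda>s'. \<forall>x<M. imem s' ''ord'' x = x)"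
  unfolding identity_loop_def
  by (rule terminates_for) (use assms in \<open>auto simp: sort_names_def less_Suc_eq\<close>)

lemma copy_loop_terminates:
  assumes "E \<notin> sort_names" and "imem s E 0 = M"
  shows "terminates (copy_loop E) s (20 * M + 20)
    (\<lambda>s'. (\<forall>x<M. imem s' ''ord'' x = imem s ''tmp'' x) \<and> imem s' ''tmp'' = imem s ''tmp'')"
  unfolding copy_loop_def
  by (rule terminates_for) (use assms in \<open>auto simp: sort_names_def less_Suc_eq\<close>)

lemma iwrites_merge_sort:
  "iwrites (merge_sort K E) = sort_names"
  "iwrites (copy_loop E) = {''q'', ''ord''}" "iwrites (identity_loop E) = {''q'', ''ord''}"
  by (auto simp: merge_sort_defs sort_names_def)

lemma rwrites_merge_sort:
  "rwrites (merge_sort K E) = {}"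
  "rwrites (copy_loop E) = {}" "rwrites (identity_loop E) = {}"
  by (auto simp: merge_sort_defs)

text \<open>The binary logarithm rounded up (0 for \<open>M = 0\<close>), which is the number of
  doublings of the width until one block covers the array.\<close>

definition passes :: "nat \<Rightarrow> nat" where
  "passes M = (LEAST r. M \<le> 2 ^ r)"

lemma passes_le: "M \<le> 2 ^ passes M"
  unfolding passes_def by (rule LeastI[of _ M]) (simp add: less_imp_le less_exp)

lemma less_passes: "r < passes M \<Longrightarrow> 2 ^ r < M"
  unfolding passes_def using not_less_Least by force

definition sort_state :: "name \<Rightarrow> name \<Rightarrow> (nat \<Rightarrow> real) \<Rightarrow> nat \<Rightarrow> nat \<Rightarrow> ram \<Rightarrow> bool" where
  "sort_state K E \<kappa> M w s \<longleftrightarrow>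
     rmem s K = \<kappa> \<and> imem s E 0 = M \<and> imem s ''width'' 0 = w \<and>
     sorted_blocks \<kappa> w M (imem s ''ord'') \<and> imem s ''ord'' ` {..<M} = {..<M}"

lemma sort_state_pass:
  assumes E: "E \<notin> sort_names" and w: "0 < w" and s: "sort_state K E \<kappa> M w s"
  shows "terminates (Seq (merge_pass K E) (Seq (copy_loop E)
         (iset ''width'' (IAdd (ivar ''width'') (ivar ''width''))))) s (120 * M + 130)
         (sort_state K E \<kappa> M (2 * w))"
proof (rule terminates_mono)
  let ?A = "imem s ''ord''" and ?double = "iset ''width'' (IAdd (ivar ''width'') (ivar ''width''))"
  from s have pass: "terminates (merge_pass K E) s (100 * M + 100) (pass_state K E \<kappa> M w ?A M)"
    by (intro merge_pass_terminates[OF E w]) (auto simp: sort_state_def)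
  show "terminates (Seq (merge_pass K E) (Seq (copy_loop E) ?double)) s
      ((100 * M + 100) + ((20 * M + 20) + cost ?double)) (sort_state K E \<kappa> M (2 * w))"
  proof (intro terminates_Seq[OF pass] terminates_Seq)
    fix s1 assume s1: "pass_state K E \<kappa> M w ?A M s1"
    then show "terminates (copy_loop E) s1 (20 * M + 20)
        (\<lambda>s2. ((\<forall>x<M. imem s2 ''ord'' x = imem s1 ''tmp'' x) \<and> imem s2 ''tmp'' = imem s1 ''tmp'') \<and>
          unchanged (copy_loop E) s1 s2)"
      by (intro terminates_frame copy_loop_terminates[OF E]) (simp add: pass_state_def)
    fix s2 assume s2: "((\<forall>x<M. imem s2 ''ord'' x = imem s1 ''tmp'' x) \<and>
      imem s2 ''tmp'' = imem s1 ''tmp'') \<and> unchanged (copy_loop E) s1 s2"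
    from s1 obtain lo i mid j hi where "merge_inv \<kappa> w M ?A (imem s1 ''tmp'') lo i mid j hi M"
      by (auto simp: pass_state_def)
    from merge_inv_final[OF this]
    have tmp: "imem s1 ''tmp'' ` {..<M} = ?A ` {..<M}" "sorted_blocks \<kappa> (2 * w) M (imem s1 ''tmp'')" .
    have "imem s2 ''ord'' ` {..<M} = {..<M}"
      using s2 tmp(1) s by (auto simp: sort_state_def cong: image_cong_simp)
    moreover have "sorted_blocks \<kappa> (2 * w) M (imem s2 ''ord'')"
      using s2 tmp(2) by (simp add: sorted_blocks_def)
    moreover have "imem s2 E = imem s1 E" "imem s2 ''width'' = imem s1 ''width''" "rmem s2 = rmem s1"
      using s2 E by (auto simp: unchanged_def iwrites_merge_sort rwrites_merge_sort sort_names_def)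
    ultimately show "terminates ?double s2 (cost ?double) (sort_state K E \<kappa> M (2 * w))"
      using s1 E
      by (intro terminates_run) (auto simp: sort_state_def pass_state_def sort_names_def)
  qed
qed auto

lemma merge_sort_terminates:
  assumes E: "E \<notin> sort_names" and s: "imem s E 0 = M"
  shows "terminates (merge_sort K E) s (150 * ((passes M + 1) * (M + 1)))
    (\<lambda>s'. (\<forall>x y. x \<le> y \<and> y < M \<longrightarrow> rmem s K (imem s' ''ord'' x) \<le> rmem s K (imem s' ''ord'' y)) \<and>
      bij_betw (imem s' ''ord'') {..<M} {..<M})"
proof (rule terminates_mono)
  let ?g = "ILess (ivar ''width'') (ivar E)"
  let ?inv = "\<lambda>r. sort_state K E (rmem s K) M (2 ^ r)"
  show "terminates (merge_sort K E) s ((20 * M + 20) + (cost (iset ''width'' (IConst 1))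
      + (passes M * (1 + bcost ?g + (120 * M + 130)) + (1 + bcost ?g)))) (?inv (passes M))"
    unfolding merge_sort_def
  proof (intro terminates_Seq)
    show "terminates (identity_loop E) s (20 * M + 20)
        (\<lambda>s'. (\<forall>x<M. imem s' ''ord'' x = x) \<and> unchanged (identity_loop E) s s')"
      by (intro terminates_frame identity_loop_terminates[OF E s])
    fix s1 assume s1: "(\<forall>x<M. imem s1 ''ord'' x = x) \<and> unchanged (identity_loop E) s s1"
    have "imem s1 E = imem s E" "rmem s1 = rmem s"
      using s1 E by (auto simp: unchanged_def iwrites_merge_sort rwrites_merge_sort sort_names_def)
    with s1 s E show "terminates (iset ''width'' (IConst 1)) s1 (cost (iset ''width'' (IConst 1))) (?inv 0)"
      by (intro terminates_run)
        (auto simp: sort_state_def sorted_blocks_def sort_names_def cong: image_cong_simp)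
  next
    fix s' assume "?inv 0 s'"
    then show "terminates (While ?g (Seq (merge_pass K E) (Seq (copy_loop E)
        (iset ''width'' (IAdd (ivar ''width'') (ivar ''width'')))))) s'
        (passes M * (1 + bcost ?g + (120 * M + 130)) + (1 + bcost ?g)) (?inv (passes M))"
    proof (intro terminates_While[where Inv = ?inv])
      fix k s' assume "k < passes M" "?inv k s'"
      then show "beval s' ?g \<and> terminates (Seq (merge_pass K E) (Seq (copy_loop E)
          (iset ''width'' (IAdd (ivar ''width'') (ivar ''width''))))) s' (120 * M + 130) (?inv (Suc k))"
        using sort_state_pass[OF E, of "2 ^ k" K "rmem s K" M s'] less_passes[of k M]
        by (auto simp: sort_state_def[where w = "2 ^ k"])
    next
      fix s' assume "?inv (passes M) s'"
      then show "\<not> beval s' ?g" using passes_le by (simp add: sort_state_def not_less)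
    qed
  qed
  show "(20 * M + 20) + (cost (iset ''width'' (IConst 1))
      + (passes M * (1 + bcost ?g + (120 * M + 130)) + (1 + bcost ?g))) \<le> 150 * ((passes M + 1) * (M + 1))"
    by (simp add: algebra_simps)
  fix s' assume s': "?inv (passes M) s'"
  \<comment> \<open>After the last pass all positions below \<open>M\<close> lie in the block with
    quotient 0.\<close>
  have "x div 2 ^ passes M = y div 2 ^ passes M" if "x \<le> y" "y < M" for x y
    using that passes_le[of M] by simp
  \<comment> \<open>The passes only track the image of \<open>ord\<close>; a map of a finite set
    onto itself is injective.\<close>
  moreover have "inj_on (imem s' ''ord'') {..<M}"
    using s' by (intro eq_card_imp_inj_on) (auto simp: sort_state_def)
  ultimately show "(\<forall>x y. x \<le> y \<and> y < M \<longrightarrow>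
        rmem s K (imem s' ''ord'' x) \<le> rmem s K (imem s' ''ord'' y)) \<and>
      bij_betw (imem s' ''ord'') {..<M} {..<M}"
    using s' by (simp add: sort_state_def sorted_blocks_def bij_betw_def)
qed


section \<open>From scenarios and items to numbered pairs and events\<close>

section \<open>The objective as a sum of hinge functions\<close>

lemma nth_concat_uniform:
  assumes "\<And>c. c \<in> set us \<Longrightarrow> length c = n" and "u < length us" and "i < n"
  shows "concat us ! (u * n + i) = us ! u ! i"
  using assms
proof (induction us arbitrary: u)
  case (Cons c us)
  then show ?case by (cases u) (auto simp: nth_append)
qed simp

lemma length_concat_uniform:
  "(\<And>c. c \<in> set us \<Longrightarrow> length c = n) \<Longrightarrow> length (concat us) = length us * n"
  by (induction us) auto

text \<open>Turns the almost sure assumptions into statements about every scenario of the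
  support.\<close>

lemma prob_pmf_zeroD:
  assumes "measure_pmf.prob p A = 0" and "c \<in> set_pmf p"
  shows "c \<notin> A"
  using assms by (auto simp: measure_pmf_zero_iff)

locale finite_sp =
  fixes I :: sp_instance and us :: "real list list"
  assumes valid: "valid_instance I" and distinct: "distinct us" and support: "set us = set_pmf (cdist I)"
begin

abbreviation n :: nat where "n \<equiv> length (sizes I)"
abbreviation m :: nat where "m \<equiv> length us"
abbreviation N :: nat where "N \<equiv> m * n"

text \<open>The pair of scenario \<open>u\<close> and item \<open>i\<close> is numbered \<open>u * n + i\<close>, as in the input array.\<close>

definition item_value :: "nat \<Rightarrow> real" where
  "item_value k = us ! (k div n) ! (k mod n)"

definition item_size :: "nat \<Rightarrow> real" where
  "item_size k = real (sizes I ! (k mod n))"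

text \<open>The negated ratio, since the sort is ascending while the follower packs by decreasing
  ratio. The machine has no unary minus, hence the subtraction from 0.\<close>

definition item_key :: "nat \<Rightarrow> real" where
  "item_key k = (0 - item_value k) / item_size k"

definition item_slope :: "nat \<Rightarrow> real" where
  "item_slope k = (if 0 < item_value k
     then pmf (cdist I) (us ! (k div n)) * real_of_int (profits I ! (k mod n)) / item_size k else 0)"

definition item_start :: "nat \<Rightarrow> real" where
  "item_start k = ahead_size (sizes I) (us ! (k div n)) (k mod n)"

text \<open>Event \<open>k\<close> is the start of pair \<open>k\<close> and event
  \<open>N + k\<close> its end. The last two events have slope zero; they make the ends of the
  capacity range breakpoints, as \<open>hinge_sum_le_breakpoints\<close> demands.\<close>

definition event_pos :: "nat \<Rightarrow> real" where
  "event_pos e =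
     (if e < N then item_start e
      else if e < 2 * N then item_start (e - N) + item_size (e - N)
      else if e = 2 * N then b_min I else b_max I)"

definition event_slope :: "nat \<Rightarrow> real" where
  "event_slope e = (if e < N then item_slope e else if e < 2 * N then - item_slope (e - N) else 0)"

abbreviation objective :: "real \<Rightarrow> real" where
  "objective \<equiv> hinge_sum event_slope event_pos (2 * N + 2) (price I)"

lemma length_scenario: "c \<in> set us \<Longrightarrow> length c = n"
  using valid support by (simp add: valid_instance_def)

lemma size_pos: "i < n \<Longrightarrow> 0 < sizes I ! i"
  using valid by (simp add: valid_instance_def)

lemma item_mod_less: "k < N \<Longrightarrow> k mod n < n"
  by (cases "n = 0") auto

lemma ratio_distinct:
  assumes "c \<in> set us" "i < n" "j < n" "i \<noteq> j"
  shows "c ! i / real (sizes I ! i) \<noteq> c ! j / real (sizes I ! j)"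
  using assms valid support unfolding valid_instance_def by (blast dest: prob_pmf_zeroD)

lemma scenario_nonzero:
  assumes "c \<in> set us" "i < n"
  shows "c ! i \<noteq> 0"
  using assms valid support unfolding valid_instance_def by (blast dest: prob_pmf_zeroD)

lemma items_div_mod:
  assumes "i < n"
  shows "(u * n + i) div n = u" "(u * n + i) mod n = i"
proof -
  have "n \<noteq> 0" using assms by auto
  with assms show "(u * n + i) div n = u" "(u * n + i) mod n = i" by simp_all
qed

text \<open>By \<open>follower_optimal_eq\<close> the reaction is determined, so the right-hand side
  does not depend on \<open>X\<close>; this is why the optimistic and the pessimistic setting
  agree.\<close>

lemma scenario_contribution:
  assumes X: "follower_response I X" and b: "b \<in> {b_min I..b_max I}" and u: "u < m"
  shows "dot (map real_of_int (profits I)) (X b (us ! u)) * pmf (cdist I) (us ! u)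
    = (\<Sum>k\<in>{u * n..<u * n + n}.
        item_slope k * (max 0 (b - item_start k) - max 0 (b - (item_start k + item_size k))))"
proof -
  let ?c = "us ! u"
  have c: "?c \<in> set us" using u by simp
  have opt: "follower_optimal (sizes I) b ?c (X b ?c)"
    using X b c support by (auto simp: follower_response_def)
  have item: "real_of_int (profits I ! i) * X b ?c ! i * pmf (cdist I) ?c
      = item_slope (u * n + i) * (max 0 (b - item_start (u * n + i))
          - max 0 (b - (item_start (u * n + i) + item_size (u * n + i))))" if i: "i < n" for i
  proof -
    have a: "real (sizes I ! i) \<noteq> 0" using size_pos[OF i] by simp
    note eq = follower_optimal_eq[OF opt length_scenario[OF c] size_pos ratio_distinct[OF c] i
        scenario_nonzero[OF c i], simplified]
    \<comment> \<open>The factor \<open>a ! i\<close> is inserted because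
      \<open>follower_optimal_eq\<close> determines the occupied capacity rather than the fraction
      packed.\<close>
    have "real_of_int (profits I ! i) * X b ?c ! i * pmf (cdist I) ?c
        = pmf (cdist I) ?c * real_of_int (profits I ! i) / real (sizes I ! i)
          * (real (sizes I ! i) * X b ?c ! i)"
      using a by simp
    then show ?thesis
      by (auto simp: eq item_slope_def item_value_def item_start_def item_size_def
          i items_div_mod[OF i])
  qed
  have "dot (map real_of_int (profits I)) (X b ?c) * pmf (cdist I) ?c
      = (\<Sum>i<n. real_of_int (profits I ! i) * X b ?c ! i * pmf (cdist I) ?c)"
    using valid by (simp add: dot_def valid_instance_def sum_distrib_right)
  also have "\<dots> = (\<Sum>i\<in>{0..<n}. item_slope (i + u * n) * (max 0 (b - item_start (i + u * n))
      - max 0 (b - (item_start (i + u * n) + item_size (i + u * n)))))"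
    using item by (intro sum.cong) (auto simp: add.commute)
  finally show ?thesis
    by (subst (asm) sum.shift_bounds_nat_ivl[symmetric]) (simp add: add.commute)
qed

lemma leader_objective_eq:
  assumes X: "follower_response I X" and b: "b \<in> {b_min I..b_max I}"
  shows "leader_objective I X b = objective b"
proof -
  let ?d = "map real_of_int (profits I)"
  let ?h = "\<lambda>k. item_slope k * (max 0 (b - item_start k) - max 0 (b - (item_start k + item_size k)))"
  have bij: "bij_betw ((!) us) {..<m} (set us)" using distinct by (intro bij_betw_nth) auto
  have pmf_sum: "(\<Sum>c\<in>set us. pmf (cdist I) c) = 1"
    using sum_pmf_eq_1[of "set us" "cdist I", OF finite_set] support by simp
  have "leader_objective I X b
      = (\<Sum>c\<in>set us. (dot ?d (X b c) - price I * b) * pmf (cdist I) c)"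
    unfolding leader_objective_def
    by (rule integral_measure_pmf_real) (simp_all add: support[symmetric])
  also have "\<dots> = (\<Sum>c\<in>set us. dot ?d (X b c) * pmf (cdist I) c) - price I * b"
    by (simp add: left_diff_distrib sum_subtractf sum_distrib_left[symmetric] pmf_sum)
  also have "(\<Sum>c\<in>set us. dot ?d (X b c) * pmf (cdist I) c)
      = (\<Sum>u<m. dot ?d (X b (us ! u)) * pmf (cdist I) (us ! u))"
    by (rule sum.reindex_bij_betw[OF bij, symmetric])
  also have "\<dots> = (\<Sum>u<m. sum ?h {u * n..<u * n + n})"
    using scenario_contribution[OF X b] by (intro sum.cong) auto
  \<comment> \<open>The blocks of length \<open>n\<close>, one per scenario, tile the range of pair
    numbers.\<close>
  also have "\<dots> = sum ?h {..<N}" by (rule sum.nat_group)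
  also have "\<dots> = (\<Sum>e<2 * N + 2. event_slope e * max 0 (b - event_pos e))"
  proof -
    let ?g = "\<lambda>e. event_slope e * max 0 (b - event_pos e)"
    have "{..<2 * N + 2} = ({..<N} \<union> {N..<N + N}) \<union> {2 * N, 2 * N + 1}" by auto
    then have "sum ?g {..<2 * N + 2} = sum ?g ({..<N} \<union> {N..<N + N}) + sum ?g {2 * N, 2 * N + 1}"
      by (simp only:) (rule sum.union_disjoint, auto)
    also have "sum ?g {2 * N, 2 * N + 1} = 0" by (simp add: event_slope_def)
    also have "sum ?g ({..<N} \<union> {N..<N + N}) = sum ?g {..<N} + sum ?g {N..<N + N}"
      by (rule sum.union_disjoint) auto
    also have "sum ?g {N..<N + N} = (\<Sum>e\<in>{0..<N}. ?g (e + N))"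
      using sum.shift_bounds_nat_ivl[of ?g 0 N N] by simp
    finally show ?thesis
      by (simp add: event_slope_def event_pos_def right_diff_distrib sum_subtractf sum_negf
          atLeast0LessThan)
  qed
  finally show ?thesis by (simp add: hinge_sum_def)
qed

lemma sp_optimal_of_events:
  assumes X: "follower_response I X" and b: "b \<in> {b_min I..b_max I}"
    and max: "\<And>e. e < 2 * N + 2 \<Longrightarrow> event_pos e \<in> {b_min I..b_max I} \<Longrightarrow>
      objective (event_pos e) \<le> objective b"
  shows "sp_optimal I X b"
proof -
  have "leader_objective I X b' \<le> leader_objective I X b" if b': "b' \<in> {b_min I..b_max I}" for b'
    unfolding leader_objective_eq[OF X b'] leader_objective_eq[OF X b]
    by (rule hinge_sum_le_breakpoints[of "2 * N" _ _ "b_min I" "2 * N + 1" "b_max I"])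
      (use b' max in \<open>auto simp: event_pos_def\<close>)
  with b show ?thesis by (simp add: sp_optimal_def is_arg_max_linorder)
qed

text \<open>In pair numbers, a larger ratio in the same scenario becomes a smaller key with the same
  quotient by \<open>n\<close>.\<close>

lemma item_start_eq:
  assumes k: "k < N"
  shows "item_start k
    = (\<Sum>k' | k' < N \<and> k' div n = k div n \<and> item_key k' < item_key k. item_size k')"
proof -
  let ?u = "k div n" and ?c = "us ! (k div n)"
  have u: "?u < m" using k by (rule less_mult_imp_div_less)
  have recompose: "?u * n + k' mod n = k'" if "k' div n = ?u" for k'
    using div_mult_mod_eq[of k' n] that by simp
  have "item_start k = (\<Sum>j | j < n \<and> ?c ! (k mod n) / real (sizes I ! (k mod n))
      < ?c ! j / real (sizes I ! j). real (sizes I ! j))"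
    by (simp add: item_start_def ahead_size_def)
  also have "\<dots> = (\<Sum>k' | k' < N \<and> k' div n = ?u \<and> item_key k' < item_key k. item_size k')"
  proof (rule sum.reindex_bij_witness[where i = "\<lambda>k'. k' mod n" and j = "\<lambda>j. ?u * n + j"])
    fix j assume "j \<in> {j. j < n \<and> ?c ! (k mod n) / real (sizes I ! (k mod n))
      < ?c ! j / real (sizes I ! j)}"
    then have j: "j < n" "?c ! (k mod n) / real (sizes I ! (k mod n)) < ?c ! j / real (sizes I ! j)"
      by auto
    have "?u * n + j < Suc ?u * n" using j by simp
    also have "\<dots> \<le> N" using u by (intro mult_le_mono1) simp
    finally show "?u * n + j \<in> {k'. k' < N \<and> k' div n = ?u \<and> item_key k' < item_key k}"
      using j by (simp add: items_div_mod item_key_def item_value_def item_size_def)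
  qed (use item_mod_less in \<open>auto simp: recompose items_div_mod item_key_def item_value_def item_size_def\<close>)
  finally show ?thesis .
qed

lemma item_key_distinct:
  assumes "k < N" "k' < N" "k div n = k' div n" "k \<noteq> k'"
  shows "item_key k \<noteq> item_key k'"
proof -
  have "k mod n \<noteq> k' mod n" using assms by (metis div_mult_mod_eq)
  moreover have "us ! (k div n) \<in> set us" using assms less_mult_imp_div_less by simp
  ultimately show ?thesis
    using ratio_distinct[of "us ! (k div n)" "k mod n" "k' mod n"] assms item_mod_less
    by (auto simp: item_key_def item_value_def item_size_def)
qed

text \<open>Keys within one scenario are distinct, so there preceding in the sorted order is the
  same as having a smaller key; ties across scenarios do no harm. One common sort thus serves all
  scenarios, with one running total of sizes for each.\<close>

lemma item_start_sorted:
  assumes bij: "bij_betw \<pi> {..<N} {..<N}"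
    and srt: "\<And>x y. x \<le> y \<Longrightarrow> y < N \<Longrightarrow> item_key (\<pi> x) \<le> item_key (\<pi> y)" and t: "t < N"
  shows "(\<Sum>e | e < t \<and> \<pi> e div n = \<pi> t div n. item_size (\<pi> e)) = item_start (\<pi> t)"
proof -
  have \<pi>: "\<pi> e < N" if "e < N" for e using bij that by (auto simp: bij_betw_def)
  have inj: "\<pi> e = \<pi> e' \<Longrightarrow> e = e'" if "e < N" "e' < N" for e e'
    using bij that by (auto simp: bij_betw_def inj_on_def)
  have less: "item_key (\<pi> e) < item_key (\<pi> t)" if "e < t" "\<pi> e div n = \<pi> t div n" for e
    using srt[of e t] item_key_distinct[of "\<pi> e" "\<pi> t"] \<pi>[of e] \<pi>[of t] inj[of e t] that t
    by force
  have "bij_betw \<pi> {e. e < t \<and> \<pi> e div n = \<pi> t div n}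
     {k'. k' < N \<and> k' div n = \<pi> t div n \<and> item_key k' < item_key (\<pi> t)}"
    unfolding bij_betw_def
  proof (intro conjI equalityI subsetI)
    show "inj_on \<pi> {e. e < t \<and> \<pi> e div n = \<pi> t div n}"
      using inj t by (auto simp: inj_on_def)
  next
    fix k' assume k': "k' \<in> {k'. k' < N \<and> k' div n = \<pi> t div n \<and> item_key k' < item_key (\<pi> t)}"
    then obtain e where e: "e < N" "k' = \<pi> e" using bij by (auto simp: bij_betw_def)
    with k' have "e < t" using srt[of t e] by force
    with e k' show "k' \<in> \<pi> ` {e. e < t \<and> \<pi> e div n = \<pi> t div n}" by auto
  qed (use \<pi> less t in auto)
  from sum.reindex_bij_betw[OF this, of item_size] show ?thesis
    by (simp add: item_start_eq[OF \<pi>[OF t]])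
qed

end


section \<open>The machine program and its phases\<close>

section \<open>The program\<close>

text \<open>The machine has no multiplication of naturals, so the number of pairs is computed by
  repeated addition.\<close>

definition count_items :: com where
  "count_items = Seq (iset ''N'' (IConst 0))
     (for_loop ''u'' ''m'' (iset ''N'' (IAdd (ivar ''N'') (ivar ''n''))))"

definition fill_item :: com where
  "fill_item =
     Seq (RPut ''key'' (ivar ''k'')
       (RDiv (RSub (RConst 0) (RGet ''c'' (ivar ''k''))) (RGet ''a'' (ivar ''i''))))
    (Seq (RPut ''size'' (ivar ''k'') (RGet ''a'' (ivar ''i'')))
    (Seq (IPut ''scen'' (ivar ''k'') (ivar ''u''))
    (Seq (RPut ''filled'' (ivar ''u'') (RConst 0))
    (Seq (Cond (RLess (RConst 0) (RGet ''c'' (ivar ''k'')))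
           (RPut ''slope'' (ivar ''k'') (RDiv (RMul (RGet ''p'' (ivar ''u'')) (RGet ''d'' (ivar ''i'')))
              (RGet ''a'' (ivar ''i''))))
           (RPut ''slope'' (ivar ''k'') (RConst 0)))
    (Seq (RPut ''slope'' (IAdd (ivar ''N'') (ivar ''k'')) (RSub (RConst 0) (RGet ''slope'' (ivar ''k''))))
    (Seq (inc ''i'')
         (Cond (ILess (ivar ''i'') (ivar ''n'')) Skip (Seq (iset ''i'' (IConst 0)) (inc ''u'')))))))))"

definition fill_items :: com where
  "fill_items = Seq (Seq (iset ''i'' (IConst 0)) (iset ''u'' (IConst 0))) (for_loop ''k'' ''N'' fill_item)"

text \<open>The running total of the pair's scenario is the start of the pair before its size is
  added, and its end afterwards.\<close>

definition place_item :: com where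
  "place_item =
     Seq (iset ''k'' (IGet ''ord'' (ivar ''t'')))
    (Seq (iset ''u'' (IGet ''scen'' (ivar ''k'')))
    (Seq (RPut ''pos'' (ivar ''k'') (RGet ''filled'' (ivar ''u'')))
    (Seq (RPut ''filled'' (ivar ''u'')
           (RAdd (RGet ''filled'' (ivar ''u'')) (RGet ''size'' (ivar ''k''))))
         (RPut ''pos'' (IAdd (ivar ''N'') (ivar ''k'')) (RGet ''filled'' (ivar ''u''))))))"

definition place_items :: com where
  "place_items = for_loop ''t'' ''N'' place_item"

definition add_bounds :: com where
  "add_bounds =
     Seq (iset ''k'' (IAdd (ivar ''N'') (ivar ''N'')))
    (Seq (RPut ''pos'' (ivar ''k'') (rvar ''b_min''))
    (Seq (RPut ''slope'' (ivar ''k'') (RConst 0))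
    (Seq (inc ''k'')
    (Seq (RPut ''pos'' (ivar ''k'') (rvar ''b_max''))
    (Seq (RPut ''slope'' (ivar ''k'') (RConst 0))
         (iset ''E'' (IAdd (ivar ''k'') (IConst 1))))))))"

text \<open>\<open>G\<close> is the slope built up so far, including the price, and \<open>H\<close>
  the sum of slope times position, so \<open>G * y - H\<close> is the objective at \<open>y\<close>
  by \<open>hinge_sum_sorted\<close>. The flag \<open>found\<close> prevents a comparison with
  \<open>value\<close> before a first candidate in the capacity range has been seen.\<close>

definition sweep_event :: com where
  "sweep_event =
     Seq (iset ''k'' (IGet ''ord'' (ivar ''t'')))
    (Seq (rset ''y'' (RGet ''pos'' (ivar ''k'')))
    (Seq (rset ''fy'' (RSub (RMul (rvar ''G'') (rvar ''y'')) (rvar ''H'')))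
    (Seq (Cond (BAnd (BAnd (BNot (RLess (rvar ''y'') (rvar ''b_min''))) (BNot (RLess (rvar ''b_max'') (rvar ''y''))))
                 (BNot (BAnd (ILess (IConst 0) (ivar ''found'')) (BNot (RLess (rvar ''value'') (rvar ''fy''))))))
           (Seq (rset ''b'' (rvar ''y'')) (Seq (rset ''value'' (rvar ''fy'')) (iset ''found'' (IConst 1))))
           Skip)
    (Seq (rset ''G'' (RAdd (rvar ''G'') (RGet ''slope'' (ivar ''k''))))
         (rset ''H'' (RAdd (rvar ''H'') (RMul (RGet ''slope'' (ivar ''k'')) (rvar ''y''))))))))"

definition sweep :: com where
  "sweep = Seq (Seq (rset ''G'' (RSub (RConst 0) (rvar ''delta''))) (Seq (rset ''H'' (RConst 0))
       (iset ''found'' (IConst 0))))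
     (for_loop ''t'' ''E'' sweep_event)"

definition solver :: com where
  "solver = Seq count_items (Seq fill_items (Seq (merge_sort ''key'' ''N'') (Seq place_items
     (Seq add_bounds (Seq (merge_sort ''pos'' ''E'') sweep)))))"

section \<open>Correctness of the individual phases\<close>

context finite_sp
begin

definition has_input :: "ram \<Rightarrow> bool" where
  "has_input s \<longleftrightarrow> imem s ''n'' 0 = n \<and> imem s ''m'' 0 = m \<and>
     (\<forall>i<n. rmem s ''a'' i = real (sizes I ! i) \<and> rmem s ''d'' i = real_of_int (profits I ! i)) \<and>
     (\<forall>k<N. rmem s ''c'' k = item_value k) \<and> (\<forall>u<m. rmem s ''p'' u = pmf (cdist I) (us ! u)) \<and>
     rmem s ''delta'' 0 = price I \<and> rmem s ''b_min'' 0 = b_min I \<and> rmem s ''b_max'' 0 = b_max I"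

lemma has_input_unchanged:
  assumes "has_input s" and "unchanged p s s'" and "{''n'', ''m''} \<inter> iwrites p = {}"
    and "{''a'', ''d'', ''c'', ''p'', ''delta'', ''b_min'', ''b_max''} \<inter> rwrites p = {}"
  shows "has_input s'"
  using assms by (simp add: has_input_def unchanged_def)

lemma has_input_input_state: "has_input (input_state I us)"
proof -
  have "array (concat us) k = item_value k" if k: "k < N" for k
    using nth_concat_uniform[OF length_scenario less_mult_imp_div_less[OF k] item_mod_less[OF k]] k
    by (simp add: array_def length_concat_uniform[OF length_scenario] item_value_def)
  moreover have "length (profits I) = n" using valid by (simp add: valid_instance_def)
  ultimately show ?thesis by (simp add: has_input_def input_state_def) (simp add: array_def)
qed

lemma count_items_terminates:
  assumes "has_input s"
  shows "terminates count_items s (30 * m + 20) (\<lambda>s'. imem s' ''N'' 0 = N)"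
  unfolding count_items_def
proof (rule terminates_mono)
  let ?inv = "\<lambda>k (s :: ram). imem s ''N'' 0 = k * n \<and> imem s ''n'' 0 = n"
  show "terminates (Seq (iset ''N'' (IConst 0))
     (for_loop ''u'' ''m'' (iset ''N'' (IAdd (ivar ''N'') (ivar ''n''))))) s
     (cost (iset ''N'' (IConst 0)) + (30 * m + 10)) (?inv m)"
  proof (rule terminates_Seq[OF terminates_run])
    fix s :: ram assume "imem s ''N'' 0 = 0 \<and> imem s ''n'' 0 = n \<and> imem s ''m'' 0 = m"
    then show "terminates (for_loop ''u'' ''m'' (iset ''N'' (IAdd (ivar ''N'') (ivar ''n'')))) s
        (30 * m + 10) (?inv m)"
      by (intro terminates_for[where Inv = ?inv]) auto
  qed (use assms in \<open>auto simp: has_input_def\<close>)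
qed auto

definition filled :: "nat \<Rightarrow> ram \<Rightarrow> bool" where
  "filled j s \<longleftrightarrow> (\<forall>k<j. rmem s ''key'' k = item_key k \<and> rmem s ''size'' k = item_size k \<and>
     imem s ''scen'' k = k div n \<and> rmem s ''filled'' (k div n) = 0 \<and>
     rmem s ''slope'' k = item_slope k \<and> rmem s ''slope'' (N + k) = - item_slope k)"

lemma fill_items_terminates:
  assumes "has_input s" and "imem s ''N'' 0 = N"
  shows "terminates fill_items s (100 * N + 20) (filled N)"
  unfolding fill_items_def
proof (rule terminates_mono)
  let ?inv = "\<lambda>k s. has_input s \<and> imem s ''N'' 0 = N \<and> imem s ''i'' 0 = k mod n \<and>
    imem s ''u'' 0 = k div n \<and> filled k s"
  let ?init = "Seq (iset ''i'' (IConst 0)) (iset ''u'' (IConst 0))"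
  have init: "?inv 0 (run ?init s)" using assms by (simp add: has_input_def filled_def)
  show "terminates (Seq ?init (for_loop ''k'' ''N'' fill_item)) s (cost ?init + (100 * N + 10)) (?inv N)"
  proof (rule terminates_Seq[OF terminates_run[where Q = "?inv 0", OF _ init]])
    fix s assume s: "?inv 0 s"
    show "terminates (for_loop ''k'' ''N'' fill_item) s (100 * N + 10) (?inv N)"
    proof (rule terminates_for[where Inv = ?inv])
      fix k s assume k: "k < N" and s: "imem s ''k'' 0 = k" "imem s ''N'' 0 = N" "?inv k s"
      have c: "rmem s ''c'' k = item_value k" and a: "rmem s ''a'' (k mod n) = item_size k"
        and p: "rmem s ''p'' (k div n) = pmf (cdist I) (us ! (k div n))"
        and d: "rmem s ''d'' (k mod n) = real_of_int (profits I ! (k mod n))"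
        using s k item_mod_less[OF k] less_mult_imp_div_less[OF k]
        by (auto simp: has_input_def item_size_def)
      define s2 where "s2 = run (Seq fill_item (inc ''k'')) s"
      \<comment> \<open>Either the next item belongs to the same scenario or the item counter wraps
        around and the scenario counter advances.\<close>
      have next_i: "Suc (k mod n) < n \<or> Suc (k mod n) = n" using item_mod_less[OF k] by linarith
      have "has_input s2" "imem s2 ''N'' 0 = N"
        using s by (auto simp: s2_def fill_item_def has_input_def)
      moreover have "imem s2 ''i'' 0 = Suc k mod n" "imem s2 ''u'' 0 = Suc k div n"
        using s next_i by (auto simp: s2_def fill_item_def has_input_def mod_Suc div_Suc)
      moreover have "filled (Suc k) s2"
        using s k by (auto simp: s2_def fill_item_def filled_def less_Suc_eq c a p d
            item_key_def item_slope_def)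
      ultimately show "?inv (Suc k) (run (Seq fill_item (inc ''k'')) s)" unfolding s2_def by blast
    qed (use s in \<open>auto simp: fill_item_def has_input_def filled_def\<close>)
  qed simp
qed auto

definition placed :: "nat \<Rightarrow> ram \<Rightarrow> bool" where
  "placed t s \<longleftrightarrow>
     (\<forall>e<t. rmem s ''pos'' (imem s ''ord'' e) = item_start (imem s ''ord'' e) \<and>
       rmem s ''pos'' (N + imem s ''ord'' e)
         = item_start (imem s ''ord'' e) + item_size (imem s ''ord'' e)) \<and>
     (\<forall>k<N. rmem s ''filled'' (k div n)
       = (\<Sum>e | e < t \<and> imem s ''ord'' e div n = k div n. item_size (imem s ''ord'' e)))"

lemma place_items_terminates:
  assumes N: "imem s ''N'' 0 = N" and fill: "filled N s"
    and srt: "\<And>x y. x \<le> y \<Longrightarrow> y < N \<Longrightarrow>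
      rmem s ''key'' (imem s ''ord'' x) \<le> rmem s ''key'' (imem s ''ord'' y)"
    and bij: "bij_betw (imem s ''ord'') {..<N} {..<N}"
  shows "terminates place_items s (100 * N + 20)
    (\<lambda>s'. \<forall>k<N. rmem s' ''pos'' k = item_start k \<and> rmem s' ''pos'' (N + k) = item_start k + item_size k)"
proof (rule terminates_mono)
  let ?\<pi> = "imem s ''ord''"
  have \<pi>: "?\<pi> e < N" if "e < N" for e using bij that by (auto simp: bij_betw_def)
  have key: "item_key (?\<pi> x) \<le> item_key (?\<pi> y)" if "x \<le> y" "y < N" for x y
    using srt[OF that] fill \<pi>[of x] \<pi>[of y] that by (simp add: filled_def)
  let ?inv = "\<lambda>t s'. placed t s' \<and> imem s' ''ord'' = ?\<pi> \<and> imem s' ''N'' 0 = N \<and>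
    (\<forall>k<N. rmem s' ''size'' k = item_size k \<and> imem s' ''scen'' k = k div n)"
  show "terminates place_items s (100 * N + 20) (?inv N)"
    unfolding place_items_def
  proof (rule terminates_for[where Inv = ?inv])
    fix t s' assume t: "t < N" and s': "imem s' ''t'' 0 = t" "imem s' ''N'' 0 = N" "?inv t s'"
    let ?k = "?\<pi> t"
    define s2 where "s2 = run (Seq place_item (inc ''t'')) s'"
    \<comment> \<open>Here the sorted order is used: the total accumulated for this scenario is
      exactly the start of the pair, by \<open>item_start_sorted\<close>.\<close>
    have filled_k: "rmem s' ''filled'' (?k div n) = item_start ?k"
      using s' \<pi>[OF t] item_start_sorted[OF bij key t] by (simp add: placed_def)
    have step: "{e. e < Suc t \<and> ?\<pi> e div n = u}
        = (if ?k div n = u then insert t else id) {e. e < t \<and> ?\<pi> e div n = u}" for u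
      by (auto simp: less_Suc_eq)
    have pos: "rmem s2 ''pos'' = (rmem s' ''pos'')(?k := item_start ?k,
        N + ?k := item_start ?k + item_size ?k)"
      and fil: "rmem s2 ''filled'' = (rmem s' ''filled'')(?k div n := item_start ?k + item_size ?k)"
      and ord: "imem s2 ''ord'' = ?\<pi>"
      using s' \<pi>[OF t] filled_k by (auto simp: s2_def place_item_def)
    have "placed (Suc t) s2"
      unfolding placed_def ord
    proof (intro conjI allI impI)
      fix e assume e: "e < Suc t"
      have "?\<pi> e < N" "?k < N" using \<pi> e t by auto
      then show "rmem s2 ''pos'' (?\<pi> e) = item_start (?\<pi> e)"
        and "rmem s2 ''pos'' (N + ?\<pi> e) = item_start (?\<pi> e) + item_size (?\<pi> e)"
        using e s' by (auto simp: pos placed_def less_Suc_eq)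
    next
      fix k assume "k < N"
      then show "rmem s2 ''filled'' (k div n)
          = (\<Sum>e | e < Suc t \<and> ?\<pi> e div n = k div n. item_size (?\<pi> e))"
        using s' filled_k by (auto simp: fil step placed_def)
    qed
    moreover have "imem s2 ''N'' 0 = N \<and>
        (\<forall>k<N. rmem s2 ''size'' k = item_size k \<and> imem s2 ''scen'' k = k div n)"
      using s' by (simp add: s2_def place_item_def)
    ultimately show "?inv (Suc t) (run (Seq place_item (inc ''t'')) s')" using ord unfolding s2_def by blast
  qed (use N fill in \<open>auto simp: place_item_def placed_def filled_def\<close>)
  fix s' assume s': "?inv N s'"
  show "\<forall>k<N. rmem s' ''pos'' k = item_start k \<and> rmem s' ''pos'' (N + k) = item_start k + item_size k"
  proof (intro allI impI)
    fix k assume "k < N"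
    then obtain e where "e < N" "k = ?\<pi> e" using bij by (auto simp: bij_betw_def)
    with s' show "rmem s' ''pos'' k = item_start k \<and>
        rmem s' ''pos'' (N + k) = item_start k + item_size k"
      by (auto simp: placed_def)
  qed
qed simp

definition has_events :: "ram \<Rightarrow> bool" where
  "has_events s \<longleftrightarrow> imem s ''E'' 0 = 2 * N + 2 \<and>
     (\<forall>e<2 * N + 2. rmem s ''pos'' e = event_pos e \<and> rmem s ''slope'' e = event_slope e)"

lemma add_bounds_terminates:
  assumes "has_input s" "imem s ''N'' 0 = N"
    and pos: "\<And>k. k < N \<Longrightarrow> rmem s ''pos'' k = item_start k"
      "\<And>k. k < N \<Longrightarrow> rmem s ''pos'' (N + k) = item_start k + item_size k"
    and slope: "\<And>k. k < N \<Longrightarrow> rmem s ''slope'' k = item_slope k"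
      "\<And>k. k < N \<Longrightarrow> rmem s ''slope'' (N + k) = - item_slope k"
  shows "terminates add_bounds s 50 has_events"
proof (rule terminates_mono[OF terminates_run])
  define s2 where "s2 = run add_bounds s"
  have mem: "rmem s2 ''pos'' = (rmem s ''pos'')(2 * N := b_min I, 2 * N + 1 := b_max I)"
    "rmem s2 ''slope'' = (rmem s ''slope'')(2 * N := 0, 2 * N + 1 := 0)"
    "imem s2 ''E'' 0 = 2 * N + 2"
    using assms(1,2) by (auto simp: s2_def add_bounds_def has_input_def mult_2)
  have "rmem s2 ''pos'' e = event_pos e \<and> rmem s2 ''slope'' e = event_slope e"
    if e: "e < 2 * N + 2" for e
  proof -
    consider "e < N" | k where "k < N" "e = N + k" | "e = 2 * N" | "e = 2 * N + 1"
    proof -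
      have "e < N \<or> (\<exists>k<N. e = N + k) \<or> e = 2 * N \<or> e = 2 * N + 1"
        using e by presburger
      with that show thesis by blast
    qed
    then show ?thesis
      by cases (auto simp: mem event_pos_def event_slope_def pos slope)
  qed
  with mem show "has_events (run add_bounds s)" by (simp add: has_events_def s2_def)
qed (auto simp: add_bounds_def)

definition best_found :: "(nat \<Rightarrow> nat) \<Rightarrow> nat \<Rightarrow> ram \<Rightarrow> bool" where
  "best_found \<pi> t s \<longleftrightarrow>
     (0 < imem s ''found'' 0 \<longrightarrow> rmem s ''b'' 0 \<in> {b_min I..b_max I} \<and>
       rmem s ''value'' 0 = objective (rmem s ''b'' 0)) \<and>
     (\<forall>e<t. event_pos (\<pi> e) \<in> {b_min I..b_max I} \<longrightarrow>
       0 < imem s ''found'' 0 \<and> objective (event_pos (\<pi> e)) \<le> rmem s ''value'' 0)"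

lemma sweep_terminates:
  assumes s: "has_input s" "has_events s"
    and srt: "\<And>x y. x \<le> y \<Longrightarrow> y < 2 * N + 2 \<Longrightarrow>
      rmem s ''pos'' (imem s ''ord'' x) \<le> rmem s ''pos'' (imem s ''ord'' y)"
    and bij: "bij_betw (imem s ''ord'') {..<2 * N + 2} {..<2 * N + 2}"
  shows "terminates sweep s (100 * (2 * N + 2) + 40)
    (\<lambda>s'. rmem s' ''b'' 0 \<in> {b_min I..b_max I} \<and> rmem s' ''value'' 0 = objective (rmem s' ''b'' 0) \<and>
      (\<forall>e<2 * N + 2. event_pos e \<in> {b_min I..b_max I} \<longrightarrow>
        objective (event_pos e) \<le> objective (rmem s' ''b'' 0)))"
  unfolding sweep_def
proof (rule terminates_mono)
  let ?\<pi> = "imem s ''ord''" and ?E = "2 * N + 2"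
  have \<pi>: "?\<pi> e < ?E" if "e < ?E" for e using bij that unfolding bij_betw_def by blast
  have ev: "event_pos (?\<pi> x) \<le> event_pos (?\<pi> y)" if "x \<le> y" "y < ?E" for x y
    using srt[OF that] s(2) \<pi>[of x] \<pi>[of y] that by (simp add: has_events_def)
  let ?inv = "\<lambda>t s'. has_input s' \<and> has_events s' \<and> imem s' ''ord'' = ?\<pi> \<and>
    rmem s' ''G'' 0 = (\<Sum>e<t. event_slope (?\<pi> e)) - price I \<and>
    rmem s' ''H'' 0 = (\<Sum>e<t. event_slope (?\<pi> e) * event_pos (?\<pi> e)) \<and> best_found ?\<pi> t s'"
  let ?init = "Seq (rset ''G'' (RSub (RConst 0) (rvar ''delta''))) (Seq (rset ''H'' (RConst 0))
       (iset ''found'' (IConst 0)))"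
  have init: "?inv 0 (run ?init s)"
    using s by (simp add: has_input_def has_events_def best_found_def)
  show "terminates (Seq ?init (for_loop ''t'' ''E'' sweep_event)) s
      (cost ?init + (100 * ?E + 10)) (?inv ?E)"
  proof (rule terminates_Seq[OF terminates_run[where Q = "?inv 0", OF _ init]])
    fix s assume s: "?inv 0 s"
    show "terminates (for_loop ''t'' ''E'' sweep_event) s (100 * ?E + 10) (?inv ?E)"
    proof (rule terminates_for[where Inv = ?inv])
      fix t s' assume t: "t < ?E" and s': "imem s' ''t'' 0 = t" "imem s' ''E'' 0 = ?E" "?inv t s'"
      define s2 where "s2 = run (Seq sweep_event (inc ''t'')) s'"
      let ?y = "event_pos (?\<pi> t)"
      have pos: "rmem s' ''pos'' (?\<pi> t) = ?y" and slope: "rmem s' ''slope'' (?\<pi> t) = event_slope (?\<pi> t)"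
        using s' \<pi>[OF t] by (auto simp: has_events_def)
      have b: "rmem s' ''b_min'' 0 = b_min I" "rmem s' ''b_max'' 0 = b_max I"
        using s' by (auto simp: has_input_def)
      have val: "((\<Sum>e<t. event_slope (?\<pi> e)) - price I) * ?y
          - (\<Sum>e<t. event_slope (?\<pi> e) * event_pos (?\<pi> e)) = objective ?y"
        using hinge_sum_sorted[where p = event_pos and \<pi> = ?\<pi>, OF bij ev t] by simp
      have "has_input s2" "has_events s2" "imem s2 ''ord'' = ?\<pi>"
        "rmem s2 ''G'' 0 = (\<Sum>e<Suc t. event_slope (?\<pi> e)) - price I"
        "rmem s2 ''H'' 0 = (\<Sum>e<Suc t. event_slope (?\<pi> e) * event_pos (?\<pi> e))"
        using s' by (auto simp: s2_def sweep_event_def has_input_def has_events_def pos slope)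
      moreover have "best_found ?\<pi> (Suc t) s2"
      proof (cases "?y \<in> {b_min I..b_max I} \<and>
          \<not> (0 < imem s' ''found'' 0 \<and> objective ?y \<le> rmem s' ''value'' 0)")
        case True
        then have "rmem s2 ''b'' 0 = ?y" "rmem s2 ''value'' 0 = objective ?y" "0 < imem s2 ''found'' 0"
          using s' by (auto simp: s2_def sweep_event_def pos b val)
        then show ?thesis
          using True s' unfolding best_found_def by (force simp: less_Suc_eq)
      next
        case False
        then have "rmem s2 ''b'' = rmem s' ''b''" "rmem s2 ''value'' = rmem s' ''value''"
          "imem s2 ''found'' = imem s' ''found''"
          using s' by (auto simp: s2_def sweep_event_def pos b val)
        then show ?thesis
          using False s' unfolding best_found_def by (auto simp: less_Suc_eq)
      qed
      ultimately show "?inv (Suc t) (run (Seq sweep_event (inc ''t'')) s')" unfolding s2_def by blast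
    qed (use s in \<open>auto simp: sweep_event_def has_events_def has_input_def best_found_def\<close>)
  qed simp
  fix s' assume "?inv ?E s'"
  then have best: "best_found ?\<pi> ?E s'" by blast
  have all: "0 < imem s' ''found'' 0 \<and> objective (event_pos e) \<le> rmem s' ''value'' 0"
    if "e < ?E" "event_pos e \<in> {b_min I..b_max I}" for e
  proof -
    have "e \<in> ?\<pi> ` {..<?E}" using bij that(1) by (simp add: bij_betw_def)
    with best that(2) show ?thesis unfolding best_found_def by blast
  qed
  \<comment> \<open>The event at the lower bound always lies in the range, so at least one candidate
    is found and the output cells hold a genuine solution.\<close>
  have "event_pos (2 * N) \<in> {b_min I..b_max I}"
    using valid by (simp add: event_pos_def valid_instance_def)
  with all[of "2 * N"] have "0 < imem s' ''found'' 0" by simp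
  with best all show "rmem s' ''b'' 0 \<in> {b_min I..b_max I} \<and>
      rmem s' ''value'' 0 = objective (rmem s' ''b'' 0) \<and>
      (\<forall>e<?E. event_pos e \<in> {b_min I..b_max I} \<longrightarrow>
        objective (event_pos e) \<le> objective (rmem s' ''b'' 0))"
    unfolding best_found_def by auto
qed auto

end


section \<open>Asymptotic running time\<close>

section \<open>Running time\<close>

lemma passes_mono: "M \<le> M' \<Longrightarrow> passes M \<le> passes M'"
  unfolding passes_def[of M] using passes_le[of M'] by (intro Least_le) simp

text \<open>By minimality of \<open>passes M\<close>, one doubling less does not reach
  \<open>M\<close>.\<close>

lemma passes_le_log:
  assumes "2 \<le> M"
  shows "real (passes M) \<le> 1 + log 2 (real M)"
proof -
  have "passes M \<noteq> 0" using passes_le[of M] assms by (intro notI) simp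
  then have "2 ^ (passes M - 1) < M" by (intro less_passes) simp
  then have "real (2 ^ (passes M - 1)) < real M" by (simp only: of_nat_less_iff)
  then have "real (passes M - 1) < log 2 (real M)"
    using less_log_of_power[of 2 "passes M - 1" "real M"] by simp
  with \<open>passes M \<noteq> 0\<close> show ?thesis by simp
qed

text \<open>The second sort dominates; it works on \<open>2 * N + 2\<close> events. The added ones
  keep the bound valid for small \<open>N\<close>, where \<open>N * ln N\<close> vanishes.\<close>

definition time_bound :: "nat \<Rightarrow> nat" where
  "time_bound N = 1200 * ((N + 1) * (passes (2 * N + 2) + 1))"

lemma time_bound_bigo: "(\<lambda>N. real (time_bound N)) \<in> O(\<lambda>N. real N * ln (real N))"
proof -
  have "real (time_bound N) \<le> 1200 * ((real N + 1) * (2 + log 2 (2 * real N + 2)))" for N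
  proof -
    have "real (passes (2 * N + 2)) + 1 \<le> 2 + log 2 (2 * real N + 2)"
      using passes_le_log[of "2 * N + 2"] by (simp add: add.commute)
    then have "(real N + 1) * (real (passes (2 * N + 2)) + 1) \<le> (real N + 1) * (2 + log 2 (2 * real N + 2))"
      by (intro mult_left_mono) auto
    moreover have "real (time_bound N) = 1200 * ((real N + 1) * (real (passes (2 * N + 2)) + 1))"
      unfolding time_bound_def by (simp only: of_nat_mult of_nat_add of_nat_1 of_nat_numeral)
    ultimately show ?thesis by linarith
  qed
  then have "(\<lambda>N. real (time_bound N)) \<in> O(\<lambda>N. 1200 * ((real N + 1) * (2 + log 2 (2 * real N + 2))))"
    by (intro bigoI[of _ 1] always_eventually allI) (smt (verit) of_nat_0_le_iff real_norm_def)
  also have "(\<lambda>N::nat. 1200 * ((real N + 1) * (2 + log 2 (2 * real N + 2)))) \<in> O(\<lambda>N. real N * ln (real N))"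
    by real_asymp
  finally show ?thesis .
qed

lemmas solver_writes =
  count_items_def fill_items_def fill_item_def place_items_def place_item_def add_bounds_def
  iwrites_merge_sort rwrites_merge_sort sort_names_def

section \<open>Total time and composition of the phases\<close>

context finite_sp
begin

text \<open>Counting the pairs takes time linear in \<open>m\<close>, which has to be absorbed by
  \<open>N + 1\<close>. For \<open>n = 0\<close> the empty vector is the only possible
  scenario.\<close>

lemma scenarios_le: "m \<le> N + 1"
proof (cases "n = 0")
  case True
  then have "set us \<subseteq> {[]}" using length_scenario by fastforce
  then have "card (set us) \<le> card {[] :: real list}" by (intro card_mono) auto
  with distinct show ?thesis by (simp add: distinct_card)
next
  case False
  then have "1 \<le> n" by linarith
  then have "m * 1 \<le> N" by (rule mult_le_mono2)
  then show ?thesis by linarith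
qed

lemma solver_time_le:
  "(30 * m + 20) + ((100 * N + 20) + (150 * ((passes N + 1) * (N + 1)) + ((100 * N + 20) + (50 +
     (150 * ((passes (2 * N + 2) + 1) * (2 * N + 2 + 1)) + (100 * (2 * N + 2) + 40)))))) \<le> time_bound N"
proof -
  define Q where "Q = (N + 1) * (passes (2 * N + 2) + 1)"
  have "N + 1 \<le> Q" by (simp add: Q_def)
  moreover have "(passes N + 1) * (N + 1) \<le> Q"
    using passes_mono[of N "2 * N + 2"] unfolding Q_def
    by (subst mult.commute) (intro mult_le_mono2, simp)
  moreover have "(passes (2 * N + 2) + 1) * (2 * N + 2 + 1) \<le> (passes (2 * N + 2) + 1) * (3 * (N + 1))"
    by (intro mult_le_mono2) simp
  then have "(passes (2 * N + 2) + 1) * (2 * N + 2 + 1) \<le> 3 * Q"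
    by (simp add: Q_def algebra_simps)
  moreover have "time_bound N = 1200 * Q" by (simp add: time_bound_def Q_def)
  \<comment> \<open>The phases need at most \<open>1030 * Q\<close>: the linear ones contribute 430,
    the first sort 150, and the second 450, its factor 3 coming from
    \<open>2 * N + 3 \<le> 3 * (N + 1)\<close>.\<close>
  moreover have "(30 * u + 20) + ((100 * k + 20) + (150 * x + ((100 * k + 20) + (50 +
      (150 * y + (100 * (2 * k + 2) + 40)))))) \<le> t"
    if "k + 1 \<le> Q" "x \<le> Q" "y \<le> 3 * Q" "t = 1200 * Q" "u \<le> k + 1" for u k x y t :: nat
    using that by simp
  ultimately show ?thesis using scenarios_le by blast
qed

lemma solver_terminates:
  "terminates solver (input_state I us) (time_bound N)
    (\<lambda>s. rmem s ''b'' 0 \<in> {b_min I..b_max I} \<and> rmem s ''value'' 0 = objective (rmem s ''b'' 0) \<and>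
      (\<forall>e<2 * N + 2. event_pos e \<in> {b_min I..b_max I} \<longrightarrow>
        objective (event_pos e) \<le> objective (rmem s ''b'' 0)))"
  unfolding solver_def
proof (rule terminates_mono[OF _ solver_time_le])
  have fill_cong: "filled j s \<Longrightarrow> unchanged p s s' \<Longrightarrow>
      {''key'', ''size'', ''slope'', ''filled''} \<inter> rwrites p = {} \<Longrightarrow>
      ''scen'' \<notin> iwrites p \<Longrightarrow> filled j s'" for j s p s'
    by (simp add: filled_def unchanged_def)
  let ?slopes = "\<lambda>s. \<forall>k<N. rmem s ''slope'' k = item_slope k \<and> rmem s ''slope'' (N + k) = - item_slope k"
  let ?sorted = "\<lambda>K M s. (\<forall>x y. x \<le> y \<and> y < M \<longrightarrow>
      rmem s K (imem s ''ord'' x) \<le> rmem s K (imem s ''ord'' y)) \<and> bij_betw (imem s ''ord'') {..<M} {..<M}"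
  \<comment> \<open>Assertions after each of the first six phases. \<open>?R4\<close> keeps only the
    slopes from \<open>filled N\<close>, because placing the items overwrites the running
    totals.\<close>
  let ?R1 = "\<lambda>s. has_input s \<and> imem s ''N'' 0 = N"
  let ?R2 = "\<lambda>s. ?R1 s \<and> filled N s"
  let ?R3 = "\<lambda>s. ?R2 s \<and> ?sorted ''key'' N s"
  let ?R4 = "\<lambda>s. ?R1 s \<and> ?slopes s \<and>
    (\<forall>k<N. rmem s ''pos'' k = item_start k \<and> rmem s ''pos'' (N + k) = item_start k + item_size k)"
  let ?R5 = "\<lambda>s. has_input s \<and> has_events s"
  let ?R6 = "\<lambda>s. ?R5 s \<and> ?sorted ''pos'' (2 * N + 2) s"
  show "terminates (Seq count_items (Seq fill_items (Seq (merge_sort ''key'' ''N'') (Seq place_items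
     (Seq add_bounds (Seq (merge_sort ''pos'' ''E'') sweep)))))) (input_state I us)
    ((30 * m + 20) + ((100 * N + 20) + (150 * ((passes N + 1) * (N + 1)) + ((100 * N + 20) + (50 +
     (150 * ((passes (2 * N + 2) + 1) * (2 * N + 2 + 1)) + (100 * (2 * N + 2) + 40)))))))
    (\<lambda>s. rmem s ''b'' 0 \<in> {b_min I..b_max I} \<and> rmem s ''value'' 0 = objective (rmem s ''b'' 0) \<and>
      (\<forall>e<2 * N + 2. event_pos e \<in> {b_min I..b_max I} \<longrightarrow>
        objective (event_pos e) \<le> objective (rmem s ''b'' 0)))"
  proof (intro terminates_Seq)
    show "terminates count_items (input_state I us) (30 * m + 20) ?R1"
      by (rule terminates_mono[OF terminates_frame[OF
            count_items_terminates[OF has_input_input_state]] order_refl])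
        (use has_input_unchanged[OF has_input_input_state, of count_items] in \<open>simp add: solver_writes\<close>)
  next
    fix s assume s: "?R1 s"
    then show "terminates fill_items s (100 * N + 20) ?R2"
      by (intro terminates_mono[OF terminates_frame[OF fill_items_terminates] order_refl])
        (use has_input_unchanged[of s fill_items] in \<open>auto simp: solver_writes unchanged_def\<close>)
  next
    fix s assume s: "?R2 s"
    show "terminates (merge_sort ''key'' ''N'') s (150 * ((passes N + 1) * (N + 1))) ?R3"
    proof (rule terminates_mono[OF terminates_frame[OF merge_sort_terminates] order_refl])
      fix s' assume s': "((\<forall>x y. x \<le> y \<and> y < N \<longrightarrow>
          rmem s ''key'' (imem s' ''ord'' x) \<le> rmem s ''key'' (imem s' ''ord'' y)) \<and>
          bij_betw (imem s' ''ord'') {..<N} {..<N}) \<and> unchanged (merge_sort ''key'' ''N'') s s'"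
      then have "has_input s'" "filled N s'"
        using s by (auto intro!: has_input_unchanged[of s "merge_sort ''key'' ''N''"]
            fill_cong[of N s "merge_sort ''key'' ''N''"] simp: solver_writes)
      moreover have "imem s' ''N'' = imem s ''N''" "rmem s' ''key'' = rmem s ''key''"
        using s' by (auto simp: unchanged_def solver_writes)
      ultimately show "?R3 s'" using s s' by simp
    qed (use s in \<open>auto simp: sort_names_def\<close>)
  next
    fix s assume s: "?R3 s"
    show "terminates place_items s (100 * N + 20) ?R4"
    proof (rule terminates_mono[OF terminates_frame[OF place_items_terminates] order_refl])
      fix s' assume s': "(\<forall>k<N. rmem s' ''pos'' k = item_start k \<and>
        rmem s' ''pos'' (N + k) = item_start k + item_size k) \<and> unchanged place_items s s'"
      then have "has_input s'"
        using s by (auto intro!: has_input_unchanged[of s place_items] simp: solver_writes)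
      moreover have "imem s' ''N'' = imem s ''N''" "rmem s' ''slope'' = rmem s ''slope''"
        using s' by (auto simp: unchanged_def solver_writes)
      ultimately show "?R4 s'" using s s' by (simp add: filled_def)
    qed (use s in auto)
  next
    fix s assume s: "?R4 s"
    then show "terminates add_bounds s 50 ?R5"
      by (intro terminates_mono[OF terminates_frame[OF add_bounds_terminates] order_refl])
        (use has_input_unchanged[of s add_bounds] in \<open>auto simp: solver_writes\<close>)
  next
    fix s assume s: "?R5 s"
    show "terminates (merge_sort ''pos'' ''E'') s
        (150 * ((passes (2 * N + 2) + 1) * (2 * N + 2 + 1))) ?R6"
    proof (rule terminates_mono[OF terminates_frame[OF merge_sort_terminates] order_refl])
      fix s' assume s': "((\<forall>x y. x \<le> y \<and> y < 2 * N + 2 \<longrightarrow>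
          rmem s ''pos'' (imem s' ''ord'' x) \<le> rmem s ''pos'' (imem s' ''ord'' y)) \<and>
          bij_betw (imem s' ''ord'') {..<2 * N + 2} {..<2 * N + 2}) \<and>
        unchanged (merge_sort ''pos'' ''E'') s s'"
      then have "has_input s'"
        using s by (auto intro!: has_input_unchanged[of s "merge_sort ''pos'' ''E''"] simp: solver_writes)
      moreover have "imem s' ''E'' = imem s ''E''" "rmem s' = rmem s"
        using s' by (auto simp: unchanged_def solver_writes)
      ultimately show "?R6 s'" using s s' by (simp add: has_events_def)
    qed (use s in \<open>auto simp: sort_names_def has_events_def\<close>)
  next
    fix s assume "?R6 s"
    then show "terminates sweep s (100 * (2 * N + 2) + 40)
      (\<lambda>s. rmem s ''b'' 0 \<in> {b_min I..b_max I} \<and> rmem s ''value'' 0 = objective (rmem s ''b'' 0) \<and>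
        (\<forall>e<2 * N + 2. event_pos e \<in> {b_min I..b_max I} \<longrightarrow>
          objective (event_pos e) \<le> objective (rmem s ''b'' 0)))"
      by (intro sweep_terminates) blast+
  qed
qed

lemma solver_solves: "solves_within solver I us (time_bound (card (set_pmf (cdist I)) * n))"
proof -
  have m: "card (set_pmf (cdist I)) = m" using distinct support by (metis distinct_card)
  obtain t s where run: "exec solver (input_state I us) t s" "t \<le> time_bound N"
    and b: "rmem s ''b'' 0 \<in> {b_min I..b_max I}" and val: "rmem s ''value'' 0 = objective (rmem s ''b'' 0)"
    and opt: "\<And>e. e < 2 * N + 2 \<Longrightarrow> event_pos e \<in> {b_min I..b_max I} \<Longrightarrow>
        objective (event_pos e) \<le> objective (rmem s ''b'' 0)"
    using solver_terminates unfolding terminates_def by blast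
  have "sp_optimal I X (rmem s ''b'' 0) \<and> rmem s ''value'' 0 = leader_objective I X (rmem s ''b'' 0)"
    if "follower_response I X" for X
    using sp_optimal_of_events[OF that b opt] leader_objective_eq[OF that b] val by simp
  with run show ?thesis unfolding solves_within_def m by blast
qed

end

theorem theorem1:
  shows "\<exists>(prog :: com) (T :: nat \<Rightarrow> nat).
    (\<lambda>N. real (T N)) \<in> O(\<lambda>N. real N * ln (real N)) \<and>
    (\<forall>(I :: sp_instance) (us :: real list list).
       valid_instance I \<and> finite (set_pmf (cdist I)) \<and>
       distinct us \<and> set us = set_pmf (cdist I) \<longrightarrow>
       solves_within prog I us (T (card (set_pmf (cdist I)) * length (sizes I))))"
proof (intro exI conjI allI impI)
  show "(\<lambda>N. real (time_bound N)) \<in> O(\<lambda>N. real N * ln (real N))" by (rule time_bound_bigo)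
  fix I us assume "valid_instance I \<and> finite (set_pmf (cdist I)) \<and> distinct us \<and> set us = set_pmf (cdist I)"
  then interpret finite_sp I us by unfold_locales auto
  show "solves_within solver I us (time_bound (card (set_pmf (cdist I)) * length (sizes I)))"
    by (rule solver_solves)
qed

end
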